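(* For every $n\in\mathbb{N}$, $n\ge 1$, the monoid $\mathcal{M}_n(\mathbb{T})$ of all $n\times n$ tropical matrices satisfies a nontrivial semigroup identity. Moreover, the length of this identity grows with $n$ as $e^{Cn^2+o(n^2)}$ for some constant $C\le 1/2+\ln 2$; that is, there are a constant $C\le 1/2+\ln 2$ and, for each $n$, a nontrivial semigroup identity $\langle u_n,v_n\rangle$ satisfied by $\mathcal{M}_n(\mathbb{T})$ whose length $L_n$ satisfies $L_n=e^{Cn^2+o(n^2)}$ as $n\to\infty$.
   Context: $\mathbb{T}=\mathbb{R}\cup\{-\infty\}$ is the max-plus (tropical) semiring: addition is $\max$ and multiplication is the usual $+$; the zero element is $-\infty$ and the multiplicative identity is $0$. $\mathcal{M}_n(\mathbb{T})$ is the monoid of all $n\times n$ matrices over $\mathbb{T}$ with the induced matrix multiplication, $(AB)_{i,j}=\max_k(A_{i,k}+B_{k,j})$. The alphabet is $\{a,b\}$, and $\{a,b\}^+$ is the free semigroup of nonempty words. A (nontrivial) semigroup identity is a pair $\langle u,v\rangle$ of two different words $u,v\in\{a,b\}^+$; its length is the maximum of the numbers of letters of $u$ and $v$. A semigroup $\mathcal{S}$ satisfies $\langle u,v\rangle$ if $\phi(u)=\phi(v)$ for every semigroup homomorphism $\phi:\{a,b\}^+\to\mathcal{S}$. *)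

theory Defs
  imports
    "HOL-Algebra.Group"
    "HOL-Library.Landau_Symbols"
    "Jordan_Normal_Form.Matrix"
begin

text \<open>
  The max-plus semiring. The type-class operations are the tropical ones: \<open>x + y\<close> is the maximum,
  \<open>x * y\<close> is ordinary addition, \<open>0\<close> is \<open>NegInf\<close> and \<open>1\<close> is \<open>Fin 0\<close>. With these, the matrix product
  of \<open>Jordan_Normal_Form.Matrix\<close> is the max-plus product (see \<open>trop_mat_mult_index\<close> below).
\<close>

datatype trop = NegInf | Fin real

instantiation trop :: linorder
begin

fun less_eq_trop :: "trop \<Rightarrow> trop \<Rightarrow> bool" where
  "NegInf \<le> (y::trop) \<longleftrightarrow> True"
| "Fin x \<le> NegInf \<longleftrightarrow> False"
| "Fin x \<le> Fin y \<longleftrightarrow> x \<le> y"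

definition less_trop :: "trop \<Rightarrow> trop \<Rightarrow> bool" where
  "less_trop x y \<longleftrightarrow> x \<le> y \<and> \<not> y \<le> x"

instance
proof
  fix x y z :: trop
  show "x < y \<longleftrightarrow> x \<le> y \<and> \<not> y \<le> x" by (rule less_trop_def)
  show "x \<le> x" by (cases x) auto
  show "x \<le> y \<Longrightarrow> y \<le> z \<Longrightarrow> x \<le> z" by (cases x; cases y; cases z) auto
  show "x \<le> y \<Longrightarrow> y \<le> x \<Longrightarrow> x = y" by (cases x; cases y) auto
  show "x \<le> y \<or> y \<le> x" by (cases x; cases y) auto
qed

end

instantiation trop :: comm_semiring_1
begin

definition zero_trop :: trop where "0 = NegInf"

definition one_trop :: trop where "1 = Fin 0"

definition plus_trop :: "trop \<Rightarrow> trop \<Rightarrow> trop" where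
  "x + y = max x (y::trop)"

fun times_trop :: "trop \<Rightarrow> trop \<Rightarrow> trop" where
  "Fin x * Fin y = Fin (x + y)"
| "NegInf * y = NegInf"
| "x * NegInf = NegInf"

instance
proof
  fix x y z :: trop
  show "x + y + z = x + (y + z)" by (simp add: plus_trop_def max.assoc)
  show "x + y = y + x" by (simp add: plus_trop_def max.commute)
  show "0 + x = x" by (cases x) (auto simp: plus_trop_def zero_trop_def max_def)
  show "x * y * z = x * (y * z)" by (cases x; cases y; cases z) auto
  show "x * y = y * x" by (cases x; cases y) auto
  show "1 * x = x" by (cases x) (auto simp: one_trop_def)
  show "(x + y) * z = x * z + y * z"
    by (cases x; cases y; cases z) (auto simp: plus_trop_def max_def)
  show "0 * x = 0" by (simp add: zero_trop_def)
  show "x * 0 = 0" by (cases x) (simp_all add: zero_trop_def)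
  show "(0::trop) \<noteq> 1" by (simp add: zero_trop_def one_trop_def)
qed

end

definition trop_mat_monoid :: "nat \<Rightarrow> trop mat monoid" where
  "trop_mat_monoid n = \<lparr>carrier = carrier_mat n n, mult = (*), one = 1\<^sub>m n\<rparr>"

lemma monoid_trop_mat_monoid: "monoid (trop_mat_monoid n)"
  by (rule monoidI) (auto simp: trop_mat_monoid_def assoc_mult_mat[of _ n n _ n _ n])

lemma trop_sum_eq_Max:
  fixes f :: "'a \<Rightarrow> trop"
  assumes "finite I" "I \<noteq> {}"
  shows "sum f I = Max (f ` I)"
  using assms by (induction rule: finite_ne_induct) (simp_all flip: plus_trop_def)

lemma trop_mat_mult_index:
  fixes A B :: "trop mat"
  assumes "A \<in> carrier_mat n n" "B \<in> carrier_mat n n" "i < n" "j < n"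
  shows "(A * B) $$ (i, j) = Max ((\<lambda>k. A $$ (i, k) * B $$ (k, j)) ` {..<n})"
proof -
  have "(A * B) $$ (i, j) = (\<Sum>k<n. A $$ (i, k) * B $$ (k, j))"
    using assms by (auto simp: scalar_prod_def atLeast0LessThan intro!: sum.cong)
  also have "\<dots> = Max ((\<lambda>k. A $$ (i, k) * B $$ (k, j)) ` {..<n})"
    using assms by (intro trop_sum_eq_Max) auto
  finally show ?thesis .
qed

datatype letter = La | Lb

text \<open>
  The free semigroup on the two letters. The library notion \<^const>\<open>hom\<close> is stated for monoid records
  but only refers to the carrier and the multiplication, so it is the set of semigroup
  homomorphisms; the \<open>one\<close> field below is not in the carrier and plays no role.
\<close>

definition free_semigroup :: "letter list monoid" where
  "free_semigroup = \<lparr>carrier = {w. w \<noteq> []}, mult = (@), one = []\<rparr>"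

definition semigroup_identity :: "letter list \<Rightarrow> letter list \<Rightarrow> bool" where
  "semigroup_identity u v \<longleftrightarrow>
     u \<in> carrier free_semigroup \<and> v \<in> carrier free_semigroup \<and> u \<noteq> v"

definition identity_length :: "letter list \<Rightarrow> letter list \<Rightarrow> nat" where
  "identity_length u v = max (length u) (length v)"

definition satisfies_identity ::
    "('a, 'b) monoid_scheme \<Rightarrow> letter list \<Rightarrow> letter list \<Rightarrow> bool" where
  "satisfies_identity S u v \<longleftrightarrow> (\<forall>\<phi>\<in>hom free_semigroup S. \<phi> u = \<phi> v)"

end

theory Submission
  imports Defs "HOL-Real_Asymp.Real_Asymp" "HOL-Computational_Algebra.Primes"
begin

text \<open>
  Induction on \<open>n\<close>. Call a matrix nonsingular if its tropical permanent is finite and attained by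
  exactly one permutation. A matrix \<open>A\<close> is either nonsingular, or its power \<open>A ^ (8 * n\<^sup>2)\<close> is a
  product \<open>C * D\<close> through dimension \<open>n - 1\<close>: if every vertex is the only optimal choice at half
  time for some pair of end points, then exchanging cycles in optimal walks shows that the vertices
  are covered by unique cycles of maximal mean, and these form the unique optimal permutation.

  Apply this to \<open>A = Y1 * Y2\<close>, where \<open>Y1 = q x q\<close>, \<open>Y2 = q y q\<close>, \<open>x = a^L b^L\<close>, \<open>y = b^L a^L\<close>,
  the number \<open>L\<close> is divisible by \<open>1, \<dots>, n\<close>, and \<open>q\<close> contains all words of length \<open>n\<close> in
  \<open>x, y\<close>. Put \<open>p = (Y1 Y2)^(8 * n\<^sup>2)\<close>. If \<open>\<langle>u, v\<rangle>\<close> is an identity of the matrices of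
  size \<open>n - 1\<close>, with \<open>u\<close> and \<open>v\<close> of equal length, then \<open>u(p Y1, p Y2) p = v(p Y1, p Y2) p\<close> for size \<open>n\<close>. If
  \<open>p = C * D\<close>, both sides are \<open>C w(D Y1 C, D Y2 C) D\<close> with \<open>w = u\<close> and \<open>w = v\<close>. If \<open>A\<close> is
  nonsingular, so are all factors of the word, and the optimal permutations compose. Hence \<open>x\<close> and
  \<open>y\<close> have the identity as optimal permutation and equal diagonals, closed walks are dominated by
  loops, and walks have fewer than \<open>n\<close> proper jumps, which can be moved away from the middle
  letter. So \<open>Y1 = Y2\<close> as matrices.

  Each step multiplies the length by at most \<open>200 * n^5 * 2^n * 4^n\<close>, the last factor coming from
  \<open>L\<close>, so that the logarithm of the length is at most \<open>3 / 2 * ln 2 * n\<^sup>2 + o(n\<^sup>2)\<close>. Padding makes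
  this exact.
\<close>

section \<open>The order of the tropical semiring\<close>

instance trop :: ordered_comm_semiring
proof
  fix a b c :: trop
  show "a \<le> b \<Longrightarrow> c + a \<le> c + b" by (auto simp: plus_trop_def max_def)
  show "a \<le> b \<Longrightarrow> 0 \<le> c \<Longrightarrow> c * a \<le> c * b"
    by (cases a; cases b; cases c) auto
qed

lemma trop_zero_le [simp]: "(0::trop) \<le> x"
  by (simp add: zero_trop_def)

lemma Fin_neq_zero [simp]: "Fin x \<noteq> 0" "0 \<noteq> Fin x"
  by (simp_all add: zero_trop_def)

lemma trop_mult_mono: "a \<le> b \<Longrightarrow> c \<le> d \<Longrightarrow> a * c \<le> b * (d::trop)"
  by (rule mult_mono) auto

lemma Fin_less_iff [simp]: "Fin x < Fin y \<longleftrightarrow> x < y"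
  by (auto simp: less_trop_def)

lemma trop_not_zeroE:
  assumes "x \<noteq> (0::trop)" obtains r where "x = Fin r"
  using assms by (cases x) (auto simp: zero_trop_def)

lemma trop_Fin_not_le_zero: "\<not> Fin r \<le> 0"
  by (simp add: zero_trop_def)

lemma trop_mult_eq_zero_iff [simp]: "(x::trop) * y = 0 \<longleftrightarrow> x = 0 \<or> y = 0"
  by (cases x; cases y) (auto simp: zero_trop_def)

lemma trop_mult_le_cancel_right:
  assumes "z \<noteq> (0::trop)" shows "x * z \<le> y * z \<longleftrightarrow> x \<le> y"
  using assms by (cases x; cases y; cases z) (auto simp: zero_trop_def)

lemma trop_mult_le_cancel_left:
  assumes "z \<noteq> (0::trop)" shows "z * x \<le> z * y \<longleftrightarrow> x \<le> y"
  using trop_mult_le_cancel_right[OF assms] by (simp add: mult.commute)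

lemma Fin_power: "Fin x ^ k = Fin (real k * x)"
  by (induction k) (auto simp: one_trop_def algebra_simps)

lemma prod_Fin: "finite I \<Longrightarrow> (\<Prod>i\<in>I. Fin (g i)) = Fin (\<Sum>i\<in>I. g i)"
  by (induction I rule: finite_induct) (auto simp: one_trop_def)

lemma trop_power_mono: "a \<le> b \<Longrightarrow> a ^ k \<le> (b::trop) ^ k"
  by (induction k) (auto intro: trop_mult_mono)

lemma trop_prod_mono:
  "(\<And>i. i \<in> I \<Longrightarrow> g i \<le> (h i :: trop)) \<Longrightarrow> (\<Prod>i\<in>I. g i) \<le> (\<Prod>i\<in>I. h i)"
  by (induction I rule: infinite_finite_induct) (auto intro: trop_mult_mono)

lemma trop_prod_eq_zero_iff:
  "finite I \<Longrightarrow> (\<Prod>i\<in>I. g i) = (0::trop) \<longleftrightarrow> (\<exists>i\<in>I. g i = 0)"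
  by (induction I rule: finite_induct) auto

lemma trop_sum_upper: "finite I \<Longrightarrow> i \<in> I \<Longrightarrow> g i \<le> (\<Sum>i\<in>I. g i :: trop)"
  by (subst trop_sum_eq_Max) auto

lemma trop_sum_attained:
  assumes "finite I" "I \<noteq> {}" shows "\<exists>i\<in>I. (\<Sum>i\<in>I. g i) = (g i :: trop)"
proof -
  have "(\<Sum>i\<in>I. g i) \<in> g ` I"
    using assms by (subst trop_sum_eq_Max) auto
  then show ?thesis by auto
qed

section \<open>Entries of matrix products as maxima over a middle index\<close>

lemma mult_mat_entry:
  assumes "A \<in> carrier_mat n m" "B \<in> carrier_mat m k" "i < n" "j < k"
  shows "(A * B) $$ (i, j) = (\<Sum>l<m. A $$ (i, l) * B $$ (l, j))"
  using assms by (auto simp: scalar_prod_def atLeast0LessThan intro!: sum.cong)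

lemma mult_mat_entry_ge:
  fixes A B :: "trop mat"
  assumes "A \<in> carrier_mat n m" "B \<in> carrier_mat m k" "i < n" "j < k" "l < m"
  shows "A $$ (i, l) * B $$ (l, j) \<le> (A * B) $$ (i, j)"
  using assms by (subst mult_mat_entry[of _ n m _ k]) (auto intro: trop_sum_upper)

lemma mult_mat_entry_attained:
  fixes A B :: "trop mat"
  assumes "A \<in> carrier_mat n m" "B \<in> carrier_mat m k" "i < n" "j < k" "0 < m"
  shows "\<exists>l<m. (A * B) $$ (i, j) = A $$ (i, l) * B $$ (l, j)"
proof -
  have "\<exists>l\<in>{..<m}. (\<Sum>l<m. A $$ (i, l) * B $$ (l, j)) = A $$ (i, l) * B $$ (l, j)"
    using assms(5) by (intro trop_sum_attained) auto
  then show ?thesis by (auto simp only: mult_mat_entry[OF assms(1-4)] lessThan_iff)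
qed

section \<open>Nonsingular tropical matrices\<close>

definition perm_weight :: "nat \<Rightarrow> trop mat \<Rightarrow> (nat \<Rightarrow> nat) \<Rightarrow> trop" where
  "perm_weight n A \<pi> = (\<Prod>i<n. A $$ (i, \<pi> i))"

definition nonsingular :: "nat \<Rightarrow> trop mat \<Rightarrow> (nat \<Rightarrow> nat) \<Rightarrow> bool" where
  "nonsingular n A \<pi> \<longleftrightarrow> \<pi> permutes {..<n} \<and> perm_weight n A \<pi> \<noteq> 0 \<and>
     (\<forall>\<rho>. \<rho> permutes {..<n} \<longrightarrow> \<rho> \<noteq> \<pi> \<longrightarrow> perm_weight n A \<rho> < perm_weight n A \<pi>)"

lemma nonsingular_unique:
  assumes "nonsingular n A \<pi>" "nonsingular n A \<rho>"
  shows "\<pi> = \<rho>"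
  using assms unfolding nonsingular_def by (metis order.asym)

lemma nonsingular_eqI:
  assumes "nonsingular n A \<pi>" "\<rho> permutes {..<n}" "perm_weight n A \<pi> \<le> perm_weight n A \<rho>"
  shows "\<rho> = \<pi>"
  using assms unfolding nonsingular_def by (meson leD)

lemma nonsingular_entry_neq_zero:
  assumes "nonsingular n A \<pi>" "i < n"
  shows "A $$ (i, \<pi> i) \<noteq> 0"
  using assms by (auto simp: nonsingular_def perm_weight_def trop_prod_eq_zero_iff)

lemma perm_weight_mult_ge:
  assumes "B \<in> carrier_mat n n" "C \<in> carrier_mat n n"
    and "\<beta> permutes {..<n}" "\<gamma> permutes {..<n}"
  shows "perm_weight n B \<beta> * perm_weight n C \<gamma> \<le> perm_weight n (B * C) (\<gamma> \<circ> \<beta>)"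
proof -
  have "perm_weight n C \<gamma> = (\<Prod>i<n. C $$ (\<beta> i, \<gamma> (\<beta> i)))"
    unfolding perm_weight_def using prod.permute[OF assms(3), of "\<lambda>i. C $$ (i, \<gamma> i)"]
    by (simp add: comp_def)
  then have "perm_weight n B \<beta> * perm_weight n C \<gamma> = (\<Prod>i<n. B $$ (i, \<beta> i) * C $$ (\<beta> i, \<gamma> (\<beta> i)))"
    by (simp add: perm_weight_def prod.distrib)
  also have "\<dots> \<le> perm_weight n (B * C) (\<gamma> \<circ> \<beta>)"
    unfolding perm_weight_def
  proof (rule trop_prod_mono)
    fix i assume "i \<in> {..<n}"
    then have "i < n" "\<beta> i < n" "\<gamma> (\<beta> i) < n"
      using permutes_in_image[OF assms(3)] permutes_in_image[OF assms(4)] by auto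
    then show "B $$ (i, \<beta> i) * C $$ (\<beta> i, \<gamma> (\<beta> i)) \<le> (B * C) $$ (i, (\<gamma> \<circ> \<beta>) i)"
      using mult_mat_entry_ge[OF assms(1,2)] by simp
  qed
  finally show ?thesis .
qed

text \<open>Each optimal entry of the product passes through a middle index
  \<open>\<kappa> i\<close>. Two equal middle indices would let the tails be exchanged, giving a
  second optimal permutation of the product. So the middle indices form a permutation, and a
  competitor in either factor, composed with the optimal permutation of the other, would compete
  with \<open>\<pi>\<close>.\<close>

lemma nonsingular_mult:
  assumes B: "B \<in> carrier_mat n n" and C: "C \<in> carrier_mat n n"
    and ns: "nonsingular n (B * C) \<pi>"
  obtains \<beta> \<gamma> where "nonsingular n B \<beta>" "nonsingular n C \<gamma>" "\<pi> = \<gamma> \<circ> \<beta>"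
    "\<And>i. i < n \<Longrightarrow> (B * C) $$ (i, \<pi> i) = B $$ (i, \<beta> i) * C $$ (\<beta> i, \<gamma> (\<beta> i))"
proof -
  let ?w = "perm_weight n"
  have perm: "\<pi> permutes {..<n}" and nz: "?w (B * C) \<pi> \<noteq> 0"
    using ns by (auto simp: nonsingular_def)
  have \<pi>n: "\<pi> i < n" if "i < n" for i
    using perm that permutes_in_image by fastforce
  have "\<exists>l<n. (B * C) $$ (i, \<pi> i) = B $$ (i, l) * C $$ (l, \<pi> i)" if "i < n" for i
    using mult_mat_entry_attained[OF B C that \<pi>n[OF that]] that by auto
  then obtain \<kappa> where \<kappa>: "\<And>i. i < n \<Longrightarrow> \<kappa> i < n"
      "\<And>i. i < n \<Longrightarrow> (B * C) $$ (i, \<pi> i) = B $$ (i, \<kappa> i) * C $$ (\<kappa> i, \<pi> i)"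
    by metis
  have inj: "inj_on \<kappa> {..<n}"
  proof (rule ccontr)
    assume "\<not> inj_on \<kappa> {..<n}"
    then obtain i j where ij: "i < n" "j < n" "i \<noteq> j" "\<kappa> i = \<kappa> j"
      by (auto simp: inj_on_def)
    let ?t = "transpose i j"
    have t: "?t permutes {..<n}" using ij by (intro permutes_swap_id) auto
    have "?w (B * C) \<pi> = (\<Prod>l<n. B $$ (l, \<kappa> l)) * (\<Prod>l<n. C $$ (\<kappa> l, \<pi> l))"
      unfolding perm_weight_def by (simp add: \<kappa>(2) prod.distrib)
    \<comment> \<open>Reindexing by the swap and using \<open>\<kappa> i = \<kappa> j\<close>
      exchanges just the two targets, at no cost.\<close>
    also have "(\<Prod>l<n. C $$ (\<kappa> l, \<pi> l)) = (\<Prod>l<n. C $$ (\<kappa> (?t l), \<pi> (?t l)))"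
      using prod.permute[OF t, of "\<lambda>l. C $$ (\<kappa> l, \<pi> l)"] by (simp add: comp_def)
    also have "\<dots> = (\<Prod>l<n. C $$ (\<kappa> l, \<pi> (?t l)))"
      using ij(4) by (intro prod.cong) (auto simp: transpose_def)
    also have "(\<Prod>l<n. B $$ (l, \<kappa> l)) * \<dots> = (\<Prod>l<n. B $$ (l, \<kappa> l) * C $$ (\<kappa> l, \<pi> (?t l)))"
      by (simp add: prod.distrib)
    also have "\<dots> \<le> ?w (B * C) (\<pi> \<circ> ?t)"
      unfolding perm_weight_def
    proof (rule trop_prod_mono)
      fix l assume "l \<in> {..<n}"
      then have "l < n" "?t l < n" using ij by (auto simp: transpose_def)
      then show "B $$ (l, \<kappa> l) * C $$ (\<kappa> l, \<pi> (?t l)) \<le> (B * C) $$ (l, (\<pi> \<circ> ?t) l)"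
        using mult_mat_entry_ge[OF B C] \<kappa>(1) \<pi>n by simp
    qed
    finally have "\<pi> \<circ> ?t = \<pi>"
      using nonsingular_eqI[OF ns] permutes_compose[OF t perm] by blast
    then have "\<pi> j = \<pi> i" by (metis comp_apply transpose_apply_first)
    then show False using permutes_inj[OF perm] ij(3) by (auto dest: injD)
  qed
  \<comment> \<open>\<open>permutes\<close> demands the identity outside the index set, where
    \<open>\<kappa>\<close> is unconstrained.\<close>
  define \<beta> where "\<beta> = (\<lambda>i. if i < n then \<kappa> i else i)"
  have "bij_betw \<kappa> {..<n} {..<n}"
    using inj \<kappa>(1) endo_inj_surj[of "{..<n}" \<kappa>] by (auto simp: bij_betw_def)
  then have \<beta>: "\<beta> permutes {..<n}"
    using bij_betw_cong[of "{..<n}" \<beta> \<kappa>] by (intro bij_imp_permutes) (auto simp: \<beta>_def)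
  define \<gamma> where "\<gamma> = \<pi> \<circ> inv_into UNIV \<beta>"
  have \<gamma>: "\<gamma> permutes {..<n}"
    unfolding \<gamma>_def by (intro permutes_compose permutes_inv \<beta> perm)
  have \<pi>: "\<pi> = \<gamma> \<circ> \<beta>"
    unfolding \<gamma>_def using permutes_inv_o(2)[OF \<beta>] by (simp add: comp_assoc)
  have entry: "(B * C) $$ (i, \<pi> i) = B $$ (i, \<beta> i) * C $$ (\<beta> i, \<gamma> (\<beta> i))" if "i < n" for i
    using \<kappa>(2)[OF that] that \<pi> by (simp add: \<beta>_def fun_eq_iff)
  have "(\<Prod>i<n. C $$ (\<beta> i, \<gamma> (\<beta> i))) = ?w C \<gamma>"
    unfolding perm_weight_def using prod.permute[OF \<beta>, of "\<lambda>i. C $$ (i, \<gamma> i)"]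
    by (simp add: comp_def)
  then have w: "?w (B * C) \<pi> = ?w B \<beta> * ?w C \<gamma>"
    unfolding perm_weight_def by (simp add: entry prod.distrib)
  then have nz': "?w B \<beta> \<noteq> 0" "?w C \<gamma> \<noteq> 0" using nz by auto
  have "nonsingular n B \<beta>"
    unfolding nonsingular_def
  proof (intro conjI allI impI)
    fix \<rho> assume \<rho>: "\<rho> permutes {..<n}" "\<rho> \<noteq> \<beta>"
    show "?w B \<rho> < ?w B \<beta>"
    proof (rule ccontr)
      assume "\<not> ?thesis"
      then have "?w (B * C) \<pi> \<le> ?w B \<rho> * ?w C \<gamma>"
        unfolding w by (intro trop_mult_mono) auto
      also have "\<dots> \<le> ?w (B * C) (\<gamma> \<circ> \<rho>)" by (rule perm_weight_mult_ge[OF B C \<rho>(1) \<gamma>])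
      finally have "\<gamma> \<circ> \<rho> = \<gamma> \<circ> \<beta>"
        using nonsingular_eqI[OF ns permutes_compose[OF \<rho>(1) \<gamma>]] \<pi> by simp
      then show False using permutes_inj[OF \<gamma>] \<rho>(2) by (metis fun.inj_map injD)
    qed
  qed (use \<beta> nz' in auto)
  moreover have "nonsingular n C \<gamma>"
    unfolding nonsingular_def
  proof (intro conjI allI impI)
    fix \<rho> assume \<rho>: "\<rho> permutes {..<n}" "\<rho> \<noteq> \<gamma>"
    show "?w C \<rho> < ?w C \<gamma>"
    proof (rule ccontr)
      assume "\<not> ?thesis"
      then have "?w (B * C) \<pi> \<le> ?w B \<beta> * ?w C \<rho>"
        unfolding w by (intro trop_mult_mono) auto
      also have "\<dots> \<le> ?w (B * C) (\<rho> \<circ> \<beta>)" by (rule perm_weight_mult_ge[OF B C \<beta> \<rho>(1)])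
      finally have "\<rho> \<circ> \<beta> = \<gamma> \<circ> \<beta>"
        using nonsingular_eqI[OF ns permutes_compose[OF \<beta> \<rho>(1)]] \<pi> by simp
      then have "\<rho> = \<gamma>"
        using permutes_surj[OF \<beta>] by (metis comp_apply surj_def ext)
      then show False using \<rho>(2) by simp
    qed
  qed (use \<gamma> nz' in auto)
  ultimately show ?thesis using that \<pi> entry by blast
qed

section \<open>Walks and powers\<close>

lemma pigeonhole_interval:
  assumes "g ` {a..<b} \<subseteq> S" "finite S" "card S < b - a"
  obtains p q :: nat where "a \<le> p" "p < q" "q < b" "g p = g q"
proof -
  have "card (g ` {a..<b}) < card {a..<b}"
    using card_mono[OF assms(2,1)] assms(3) by simp
  then have "\<not> inj_on g {a..<b}" by (rule pigeonhole)
  then obtain p q where "p \<in> {a..<b}" "q \<in> {a..<b}" "p \<noteq> q" "g p = g q"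
    by (auto simp: inj_on_def)
  then show ?thesis using that[of p q] that[of q p] by (cases "p < q") auto
qed

locale tropical_matrix =
  fixes n :: nat and A :: "trop mat"
  assumes A: "A \<in> carrier_mat n n" and n_pos: "0 < n"
begin

text \<open>The greatest weight of a walk of length \<open>m\<close> from \<open>i\<close> to
  \<open>j\<close>, with the tropical zero when no walk of finite weight exists.\<close>

abbreviation B :: "nat \<Rightarrow> nat \<Rightarrow> nat \<Rightarrow> trop" where
  "B m i j \<equiv> (A ^\<^sub>m m) $$ (i, j)"

lemma pow_carrier [simp]: "A ^\<^sub>m m \<in> carrier_mat n n"
  using A by (induction m) auto

lemma pow_add: "A ^\<^sub>m (p + q) = A ^\<^sub>m p * A ^\<^sub>m q"
proof (induction q)
  case 0
  show ?case using right_mult_one_mat[OF pow_carrier] A by auto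
next
  case (Suc q)
  then show ?case using assoc_mult_mat[OF pow_carrier pow_carrier A] by simp
qed

lemma B_0: "i < n \<Longrightarrow> j < n \<Longrightarrow> B 0 i j = (if i = j then 1 else 0)"
  using A by auto

lemma B_1: "i < n \<Longrightarrow> j < n \<Longrightarrow> B (Suc 0) i j = A $$ (i, j)"
  using A by simp

lemma B_add_ge: "x < n \<Longrightarrow> y < n \<Longrightarrow> z < n \<Longrightarrow> B p x z * B q z y \<le> B (p + q) x y"
  unfolding pow_add by (rule mult_mat_entry_ge) auto

lemma B_add_attained:
  "x < n \<Longrightarrow> y < n \<Longrightarrow> \<exists>z<n. B (p + q) x y = B p x z * B q z y"
  unfolding pow_add by (rule mult_mat_entry_attained) (use n_pos in auto)

lemma B_power: "i < n \<Longrightarrow> B d i i ^ k \<le> B (k * d) i i"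
proof (induction k)
  case (Suc k)
  have "B d i i ^ Suc k \<le> B d i i * B (k * d) i i"
    using Suc by (auto intro: trop_mult_mono)
  also have "\<dots> \<le> B (d + k * d) i i" using Suc.prems by (intro B_add_ge)
  finally show ?case by simp
qed (simp add: B_0 del: pow_mat.simps)

section \<open>Walks, their weights and the removal of closed subwalks\<close>

definition weight :: "(nat \<Rightarrow> nat) \<Rightarrow> nat \<Rightarrow> nat \<Rightarrow> trop" where
  "weight f a b = (\<Prod>k=a..<b. A $$ (f k, f (Suc k)))"

lemma weight_same [simp]: "weight f a a = 1"
  by (simp add: weight_def)

lemma weight_Suc: "a \<le> b \<Longrightarrow> weight f a (Suc b) = weight f a b * A $$ (f b, f (Suc b))"
  by (simp add: weight_def)

lemma weight_split: "a \<le> p \<Longrightarrow> p \<le> b \<Longrightarrow> weight f a b = weight f a p * weight f p b"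
  by (simp add: weight_def prod.atLeastLessThan_concat)

lemma weight_cong:
  "(\<And>k. a \<le> k \<Longrightarrow> k \<le> b \<Longrightarrow> f k = g k) \<Longrightarrow> weight f a b = weight g a b"
  by (auto simp: weight_def intro!: prod.cong)

lemma weight_le:
  assumes "\<And>k. f k < n" "a \<le> b"
  shows "weight f a b \<le> B (b - a) (f a) (f b)"
  using assms(2)
proof (induction b rule: dec_induct)
  case base
  show ?case using assms(1) by (simp add: B_0 del: pow_mat.simps)
next
  case (step b)
  have "weight f a (Suc b) = weight f a b * B 1 (f b) (f (Suc b))"
    using step assms(1) by (simp add: weight_Suc B_1 del: pow_mat.simps)
  also have "\<dots> \<le> B (b - a) (f a) (f b) * B 1 (f b) (f (Suc b))"
    using step by (intro trop_mult_mono) auto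
  also have "\<dots> \<le> B (b - a + 1) (f a) (f (Suc b))"
    using assms(1) by (intro B_add_ge)
  finally show ?case using step by (simp add: Suc_diff_le del: pow_mat.simps)
qed

text \<open>Walks are functions on all times, so that their range is the set of visited vertices;
  freezing the walk at \<open>y\<close> from time \<open>m\<close> on adds no vertex to that
  range.\<close>

lemma walk_exists:
  assumes "x < n" "y < n" "B m x y \<noteq> 0"
  shows "\<exists>f. (\<forall>k. f k < n) \<and> f 0 = x \<and> (\<forall>k\<ge>m. f k = y) \<and> weight f 0 m = B m x y"
  using assms(2,3)
proof (induction m arbitrary: y)
  case 0
  then have "x = y" using assms(1) B_0 by metis
  with assms(1) show ?case by (intro exI[of _ "\<lambda>_. x"]) (simp add: B_0 del: pow_mat.simps)
next
  case (Suc m)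
  obtain z where z: "z < n" "B (Suc m) x y = B m x z * A $$ (z, y)"
    using B_add_attained[OF assms(1) Suc.prems(1), of m 1] B_1 Suc.prems(1)
    by (auto simp del: pow_mat.simps)
  with Suc.prems have "B m x z \<noteq> 0" by auto
  with Suc.IH[OF z(1)] obtain f where f: "\<And>k. f k < n" "f 0 = x" "\<And>k. k \<ge> m \<Longrightarrow> f k = z"
      "weight f 0 m = B m x z" by blast
  let ?g = "\<lambda>k. if k \<le> m then f k else y"
  have "weight ?g 0 (Suc m) = weight f 0 m * A $$ (z, y)"
    using weight_cong[of 0 m ?g f] f(3)[of m] by (simp add: weight_Suc)
  then show ?case using f z Suc.prems by (intro exI[of _ ?g]) auto
qed

text \<open>Intended for \<open>f p = f q\<close>: a closed subwalk is cut out, and the two branches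
  agree at the seam.\<close>

definition splice :: "(nat \<Rightarrow> nat) \<Rightarrow> nat \<Rightarrow> nat \<Rightarrow> nat \<Rightarrow> nat" where
  "splice f p q = (\<lambda>k. if k \<le> p then f k else f (k + (q - p)))"

lemma splice_simps:
  assumes "a \<le> p" "p < q" "q \<le> b" "f p = f q"
  shows "splice f p q a = f a" "splice f p q (b - (q - p)) = f b"
    "weight f a b = weight (splice f p q) a (b - (q - p)) * weight f p q"
proof -
  let ?g = "splice f p q"
  show "?g a = f a" using assms by (simp add: splice_def)
  show "?g (b - (q - p)) = f b"
  proof (cases "b = q")
    case True
    then show ?thesis using assms by (simp add: splice_def)
  next
    case False
    then show ?thesis using assms by (auto simp: splice_def)
  qed
  have "weight ?g p (b - (q - p)) = (\<Prod>k=p..<b - (q - p). A $$ (f (k + (q - p)), f (Suc k + (q - p))))"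
    unfolding weight_def using assms by (intro prod.cong) (auto simp: splice_def)
  also have "\<dots> = weight f q b"
    unfolding weight_def using assms prod.shift_bounds_nat_ivl
      [of "\<lambda>k. A $$ (f k, f (Suc k))" p "q - p" "b - (q - p)"] by simp
  finally have "weight ?g p (b - (q - p)) = weight f q b" .
  moreover have "weight ?g a p = weight f a p"
    by (rule weight_cong) (simp add: splice_def)
  moreover have "p \<le> b - (q - p)" using assms by simp
  ultimately have "weight ?g a (b - (q - p)) = weight f a p * weight f q b"
    using weight_split[of a p "b - (q - p)" ?g] assms by simp
  then show "weight f a b = weight ?g a (b - (q - p)) * weight f p q"
    using assms weight_split[of a p b f] weight_split[of p q b f] by (simp add: mult_ac)
qed

lemma splice_in: "(\<And>k. f k \<in> H) \<Longrightarrow> splice f p q k \<in> H"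
  by (simp add: splice_def)

text \<open>A closed walk of more than \<open>n\<close> steps contains a proper closed subwalk.
  Cutting it out leaves two shorter closed walks whose lengths and weights add up, so the bound for
  lengths up to \<open>n\<close> propagates. The set \<open>H\<close> keeps the hypothesis local,
  since the mean may be larger at other vertices.\<close>

lemma closed_walk_mean_le:
  assumes H: "H \<subseteq> {..<n}"
    and mean: "\<And>z d. z \<in> H \<Longrightarrow> 1 \<le> d \<Longrightarrow> d \<le> n \<Longrightarrow> B d z z \<le> Fin (real d * \<mu>)"
    and "\<And>k. f k \<in> H" "a \<le> b" "f a = f b"
  shows "weight f a b \<le> Fin (real (b - a) * \<mu>)"
  using assms(3-5)
proof (induction "b - a" arbitrary: f a b rule: less_induct)
  case less
  have fn: "f k < n" for k using less.prems(1)[of k] H by auto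
  consider "a = b" | "a < b" "b - a \<le> n" | "n < b - a" using less.prems by linarith
  then show ?case
  proof cases
    case 1
    then show ?thesis by (simp add: one_trop_def)
  next
    case 2
    then show ?thesis
      using weight_le[of f a b, OF fn] mean[of "f a" "b - a"] less.prems by (auto intro: order_trans)
  next
    case 3
    obtain p q where pq: "a \<le> p" "p < q" "q < b" "f p = f q"
      using pigeonhole_interval[of f a b "{..<n}"] fn 3 by auto
    have "weight (splice f p q) a (b - (q - p)) \<le> Fin (real (b - (q - p) - a) * \<mu>)"
      using pq splice_simps[of a p q b f] less.prems splice_in[of f H p q]
      by (intro less.hyps) auto
    moreover have "weight f p q \<le> Fin (real (q - p) * \<mu>)"
      using pq less.prems by (intro less.hyps) auto
    ultimately have "weight f a b \<le> Fin (real (b - (q - p) - a) * \<mu>) * Fin (real (q - p) * \<mu>)"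
      unfolding splice_simps(3)[OF pq(1,2) less_imp_le[OF pq(3)] pq(4)] by (rule trop_mult_mono)
    also have "\<dots> = Fin (real (b - a) * \<mu>)"
      using pq by (simp add: of_nat_diff algebra_simps)
    finally show ?thesis .
  qed
qed

text \<open>Among \<open>n * l + 1\<close> consecutive times, two have the same vertex and the same residue
  modulo \<open>l\<close>, so long walks can be shortened by multiples of \<open>l\<close>.\<close>

lemma walk_reduction:
  assumes H: "H \<subseteq> {..<n}"
    and mean: "\<And>z d. z \<in> H \<Longrightarrow> 1 \<le> d \<Longrightarrow> d \<le> n \<Longrightarrow> B d z z \<le> Fin (real d * \<mu>)"
    and l: "0 < l"
    and "\<And>k. f k \<in> H" "a \<le> b"
  shows "\<exists>r. r \<le> n * l \<and> r \<le> b - a \<and> l dvd b - a - r \<and>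
    weight f a b \<le> B r (f a) (f b) * Fin (real (b - a - r) * \<mu>)"
  using assms(4,5)
proof (induction "b - a" arbitrary: f b rule: less_induct)
  case less
  have fn: "f k < n" for k using less.prems(1)[of k] H by auto
  show ?case
  proof (cases "b - a \<le> n * l")
    case True
    then show ?thesis using weight_le[OF fn, of a b] less.prems
      by (intro exI[of _ "b - a"]) (auto simp flip: one_trop_def)
  next
    case False
    obtain p q where pq: "a \<le> p" "p < q" "q < b" "(f p, p mod l) = (f q, q mod l)"
    proof (rule pigeonhole_interval[of "\<lambda>k. (f k, k mod l)" a b "{..<n} \<times> {..<l}"])
      show "(\<lambda>k. (f k, k mod l)) ` {a..<b} \<subseteq> {..<n} \<times> {..<l}" using fn l by auto
      show "card ({..<n} \<times> {..<l}) < b - a" using False by simp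
    qed auto
    let ?g = "splice f p q" and ?c = "b - (q - p)"
    have "?c - a < b - a" "a \<le> ?c" using pq by auto
    then obtain r where r: "r \<le> n * l" "r \<le> ?c - a" "l dvd ?c - a - r"
        "weight ?g a ?c \<le> B r (?g a) (?g ?c) * Fin (real (?c - a - r) * \<mu>)"
      using less.hyps[of ?c ?g, OF _ splice_in[OF less.prems(1)]] by blast
    have dvd: "l dvd q - p" using pq mod_eq_dvd_iff_nat[of p q l] by simp
    have "weight f p q \<le> Fin (real (q - p) * \<mu>)"
      using pq by (intro closed_walk_mean_le[OF H mean] less.prems) auto
    then have "weight f a b \<le>
        B r (f a) (f b) * Fin (real (?c - a - r) * \<mu>) * Fin (real (q - p) * \<mu>)"
      using splice_simps[of a p q b f] pq r(4) by (auto intro: trop_mult_mono)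
    also have "\<dots> = B r (f a) (f b) * Fin (real (b - a - r) * \<mu>)"
      using pq r(2) by (simp add: mult.assoc of_nat_diff algebra_simps)
    finally have "weight f a b \<le> B r (f a) (f b) * Fin (real (b - a - r) * \<mu>)" .
    moreover have "b - a - r = (?c - a - r) + (q - p)" using pq r(2) by simp
    then have "l dvd b - a - r" using dvd r(3) by simp
    ultimately show ?thesis using r pq by (intro exI[of _ r]) auto
  qed
qed

end

context tropical_matrix begin

text \<open>In an optimal walk all closed subwalks may be traded for copies of the cycle of maximal mean
  that it meets. Then the walk is on that cycle at half time, so the forced vertex lies on it.\<close>

lemma forced_midpoint:
  assumes xyi: "x < n" "y < n" "i < n" and s: "4 * n * n \<le> s"
    and V: "B s x i * B s i y \<noteq> 0"
    and forced: "\<And>k. k < n \<Longrightarrow> k \<noteq> i \<Longrightarrow> B s x k * B s k y < B s x i * B s i y"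
  obtains l \<mu> where "1 \<le> l" "l \<le> n" "B l i i = Fin (real l * \<mu>)"
    "\<And>e e' k. e \<le> 2 * n \<Longrightarrow> e' \<le> 2 * n \<Longrightarrow> k < n \<Longrightarrow>
       B (e * l) i k * B (e' * l) k i \<le> Fin (real ((e + e') * l) * \<mu>)"
    "\<And>e e' k. e \<le> 2 * n \<Longrightarrow> e' \<le> 2 * n \<Longrightarrow> k < n \<Longrightarrow> k \<noteq> i \<Longrightarrow>
       B (e * l) i k * B (e' * l) k i < Fin (real ((e + e') * l) * \<mu>)"
proof -
  define V where "V = B s x i * B s i y"
  have Vnz: "V \<noteq> 0" using V by (simp add: V_def)
  have Vmax: "B s x k * B s k y \<le> V" if "k < n" for k
    using forced[OF that] by (cases "k = i") (auto simp: V_def)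
  have Vforced: "k = i" if "k < n" "V \<le> B s x k * B s k y" for k
    using forced[OF that(1)] that(2) by (auto simp: V_def not_less[symmetric])
  have nn: "n \<le> n * n" using n_pos by simp
  have s': "4 * (n * n) \<le> s" using s by (simp add: mult.assoc)
  obtain k0 where k0: "k0 < n" "B (s + s) x y = B s x k0 * B s k0 y"
    using B_add_attained[OF xyi(1,2)] by blast
  have "V \<le> B (s + s) x y" unfolding V_def by (intro B_add_ge xyi)
  then have BV: "B (2 * s) x y = V" using Vmax[OF k0(1)] k0(2) by (simp add: mult_2)
  obtain f where f: "\<And>k. f k < n" "f 0 = x" "\<And>k. k \<ge> 2 * s \<Longrightarrow> f k = y"
      "weight f 0 (2 * s) = V"
    using walk_exists[OF xyi(1,2), of "2 * s"] Vnz BV by auto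
  define H where "H = range f"
  have H: "H \<subseteq> {..<n}" and fH: "f k \<in> H" for k using f(1) by (auto simp: H_def)
  \<comment> \<open>\<open>rv\<close> reads off a finite value; its default 0 is never met, as
    \<open>P\<close> collects only closed walks of finite weight.\<close>
  define rv where "rv w = (case w of Fin r \<Rightarrow> r | NegInf \<Rightarrow> 0)" for w
  define P where "P = {(z, d). z \<in> H \<and> d \<in> {1..n} \<and> B d z z \<noteq> 0}"
  define val where "val = (\<lambda>(z, d). rv (B d z z) / real d)"
  have finP: "finite P"
    by (rule finite_subset[of _ "{..<n} \<times> {1..n}"]) (use H in \<open>auto simp: P_def\<close>)
  obtain p q where pq: "p < q" "q \<le> n" "f p = f q"
  proof (rule pigeonhole_interval[of f 0 "Suc n" "{..<n}"])
    show "f ` {0..<Suc n} \<subseteq> {..<n}" using f(1) by auto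
  qed auto
  have "q \<le> 2 * s" using pq(2) nn s' by linarith
  then have "weight f 0 (2 * s) = weight f 0 p * (weight f p q * weight f q (2 * s))"
    using pq weight_split[of 0 p "2 * s" f] weight_split[of p q "2 * s" f] by simp
  then have "weight f p q \<noteq> 0" using f(4) Vnz by auto
  moreover have "weight f p q \<le> B (q - p) (f p) (f p)"
    using weight_le[of f p q] f(1) pq by auto
  ultimately have "B (q - p) (f p) (f p) \<noteq> 0"
    using trop_zero_le order_antisym by metis
  then have "(f p, q - p) \<in> P" using pq fH by (auto simp: P_def)
  then have neP: "P \<noteq> {}" by auto
  \<comment> \<open>The greatest mean of a closed walk of length at most \<open>n\<close> at a
    visited vertex. It is attained at \<open>z\<close> with length \<open>l\<close>.\<close>
  define \<mu> where "\<mu> = Max (val ` P)"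
  have "\<mu> \<in> val ` P" unfolding \<mu>_def using finP neP by (intro Max_in) auto
  then obtain z l where zl: "z \<in> H" "1 \<le> l" "l \<le> n" "B l z z \<noteq> 0" "\<mu> = val (z, l)"
    by (auto simp: P_def)
  have Bl: "B l z z = Fin (real l * \<mu>)"
    using zl by (auto simp: val_def rv_def elim!: trop_not_zeroE)
  have mean: "B d w w \<le> Fin (real d * \<mu>)" if "w \<in> H" "1 \<le> d" "d \<le> n" for w d
  proof (cases "B d w w = 0")
    case False
    then have "(w, d) \<in> P" using that by (auto simp: P_def)
    then have "val (w, d) \<le> \<mu>" unfolding \<mu>_def using finP by (intro Max_ge) auto
    then show ?thesis using that False
      by (auto simp: val_def rv_def field_simps elim!: trop_not_zeroE)
  qed simp
  obtain \<tau> where \<tau>: "z = f \<tau>" "\<tau> \<le> 2 * s"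
  proof -
    obtain t where "z = f t" using zl(1) by (auto simp: H_def)
    then have "z = f (min t (2 * s))" using f(3) by (auto simp: min_def)
    then show ?thesis using that by auto
  qed
  have zn: "z < n" using zl(1) H by auto
  have fy: "f (2 * s) = y" using f(3) by simp
  \<comment> \<open>The walk is cut at a time \<open>\<tau>\<close> when it visits \<open>z\<close>.
    Both pieces are shortened by multiples of \<open>l\<close>, and the \<open>m\<close> freed
    blocks become copies of the cycle at \<open>z\<close>.\<close>
  have red: "\<exists>r. r \<le> n * l \<and> r \<le> b - a \<and> l dvd b - a - r \<and>
      weight f a b \<le> B r (f a) (f b) * Fin (real (b - a - r) * \<mu>)" if "a \<le> b" for a b
    by (rule walk_reduction[OF H]) (use mean fH zl that in auto)
  obtain r1 where r1: "r1 \<le> n * l" "r1 \<le> \<tau>" "l dvd \<tau> - r1"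
      "weight f 0 \<tau> \<le> B r1 x z * Fin (real (\<tau> - r1) * \<mu>)"
    using red[of 0 \<tau>] unfolding diff_zero f(2) \<tau>(1)[symmetric] by blast
  obtain r2 where r2: "r2 \<le> n * l" "r2 \<le> 2 * s - \<tau>" "l dvd 2 * s - \<tau> - r2"
      "weight f \<tau> (2 * s) \<le> B r2 z y * Fin (real (2 * s - \<tau> - r2) * \<mu>)"
    using red[OF \<tau>(2)] unfolding fy \<tau>(1)[symmetric] by blast
  obtain m where m: "2 * s = r1 + r2 + m * l"
  proof -
    have "l dvd (\<tau> - r1) + (2 * s - \<tau> - r2)" using r1 r2 by (intro dvd_add)
    then obtain m where "(\<tau> - r1) + (2 * s - \<tau> - r2) = l * m" by blast
    then show ?thesis using r1 r2 \<tau> that[of m] by (simp add: mult.commute)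
  qed
  have len: "real (\<tau> - r1) + real (2 * s - \<tau> - r2) = real m * real l"
  proof -
    have "(\<tau> - r1) + (2 * s - \<tau> - r2) = m * l" using m r1(2) r2(2) \<tau>(2) by simp
    then show ?thesis by (metis of_nat_add of_nat_mult)
  qed
  have "V \<le> (B r1 x z * Fin (real (\<tau> - r1) * \<mu>)) * (B r2 z y * Fin (real (2 * s - \<tau> - r2) * \<mu>))"
    using weight_split[of 0 \<tau> "2 * s" f] \<tau>(2) f(4) r1(4) r2(4) by (auto intro: trop_mult_mono)
  also have "\<dots> = B r1 x z * B r2 z y * Fin (real m * real l * \<mu>)"
    unfolding len[symmetric] by (simp add: mult_ac distrib_left flip: times_trop.simps)
  finally have V1: "V \<le> B r1 x z * B r2 z y * Fin (real m * real l * \<mu>)" .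
  have nl: "n * l \<le> n * n" "2 * n * l \<le> 2 * n * n" using zl by auto
  \<comment> \<open>\<open>a\<close> whole copies of the cycle fit before half time, which falls
    \<open>e0\<close> steps into the next copy.\<close>
  define a where "a = (s - r1) div l"
  define e0 where "e0 = (s - r1) mod l"
  have "r1 \<le> s" using r1(1) nl s' by linarith
  then have sa: "s = r1 + e0 + a * l" by (simp add: a_def e0_def)
  have e0: "e0 < l" using zl by (simp add: e0_def)
  \<comment> \<open>One copy is set apart because half time cuts it, at the vertex \<open>k\<close>
    below, into pieces of lengths \<open>e0\<close> and \<open>l - e0\<close>.\<close>
  define b where "b = m - a - 1"
  have "r2 + l \<le> s" using r2(1) nl s' nn zl by linarith
  then have "a * l < m * l" using m sa e0 by linarith
  then have am: "m = a + b + 1" by (simp add: b_def)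
  have sb: "s = r2 + (l - e0) + b * l"
    using m sa e0 unfolding am by (simp add: algebra_simps)
  obtain k where k: "k < n" "B l z z = B e0 z k * B (l - e0) k z"
    using B_add_attained[OF zn zn, of e0 "l - e0"] e0 by auto
  define R1 where "R1 = B r1 x z * B e0 z k"
  define R2 where "R2 = B (l - e0) k z * B r2 z y"
  have pow: "Fin (real (c * l) * \<mu>) = B l z z ^ c" for c
    by (simp add: Bl Fin_power)
  have "B r1 x z * B r2 z y * Fin (real m * real l * \<mu>)
      = B r1 x z * B r2 z y * (B l z z * Fin (real ((a + b) * l) * \<mu>))"
    unfolding am Bl by (simp add: algebra_simps)
  also have "\<dots> = R1 * R2 * Fin (real ((a + b) * l) * \<mu>)"
    unfolding R1_def R2_def k(2) by (simp add: mult_ac)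
  finally have V2: "V \<le> R1 * R2 * Fin (real ((a + b) * l) * \<mu>)" using V1 by simp
  \<comment> \<open>The rearranged walk is still optimal and is at \<open>k\<close> at half time, so
    the forced vertex is this vertex of the cycle.\<close>
  have "k = i"
  proof (rule Vforced[OF k(1)])
    have "R1 * Fin (real (a * l) * \<mu>) \<le> B r1 x z * (B (a * l) z z * B e0 z k)"
      unfolding pow R1_def using B_power[OF zn, of l a] by (auto simp: mult_ac intro!: trop_mult_mono)
    also have "\<dots> \<le> B r1 x z * B (a * l + e0) z k"
      by (intro trop_mult_mono B_add_ge zn k) auto
    also have "\<dots> \<le> B (r1 + (a * l + e0)) x k" by (intro B_add_ge zn k xyi)
    finally have L: "R1 * Fin (real (a * l) * \<mu>) \<le> B s x k" using sa by (simp add: ac_simps)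
    have "R2 * Fin (real (b * l) * \<mu>) \<le> B (l - e0) k z * (B (b * l) z z * B r2 z y)"
      unfolding pow R2_def using B_power[OF zn, of l b] by (auto simp: mult_ac intro!: trop_mult_mono)
    also have "\<dots> \<le> B (l - e0) k z * B (b * l + r2) z y"
      by (intro trop_mult_mono B_add_ge zn k xyi) auto
    also have "\<dots> \<le> B (l - e0 + (b * l + r2)) k y" by (intro B_add_ge zn k xyi)
    finally have R: "R2 * Fin (real (b * l) * \<mu>) \<le> B s k y" using sb by (simp add: ac_simps)
    have "R1 * R2 * Fin (real ((a + b) * l) * \<mu>)
        = (R1 * Fin (real (a * l) * \<mu>)) * (R2 * Fin (real (b * l) * \<mu>))"
      by (simp add: mult_ac algebra_simps flip: times_trop.simps)
    also have "\<dots> \<le> B s x k * B s k y" by (intro trop_mult_mono L R)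
    finally show "V \<le> B s x k * B s k y" using V2 by simp
  qed
  have L: "R1 \<le> B (r1 + e0) x i" and R: "R2 \<le> B (l - e0 + r2) i y"
    unfolding R1_def R2_def \<open>k = i\<close> by (intro B_add_ge xyi zn)+
  \<comment> \<open>The cycle at \<open>z\<close> passes through \<open>i\<close>, hence can be
    started there.\<close>
  have Bi: "Fin (real l * \<mu>) \<le> B l i i"
    using B_add_ge[OF xyi(3) xyi(3) zn, of "l - e0" e0] k(2) e0 Bl \<open>k = i\<close> by (simp add: mult.commute)
  have powi: "Fin (real (c * l) * \<mu>) \<le> B (c * l) i i" for c
    using order_trans[OF trop_power_mono[OF Bi, of c] B_power[OF xyi(3), of l c]]
    by (simp add: Fin_power mult_ac)
  have Rnz: "R1 * R2 \<noteq> 0" using V2 Vnz by (metis mult_zero_left order_antisym trop_zero_le)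
  \<comment> \<open>Outside the whole copies, at most \<open>n * n + n\<close> steps are spent on
    each side of half time, so \<open>4 * n * n \<le> s\<close> leaves room for \<open>2 * n\<close>
    copies on each side.\<close>
  have ab: "2 * n \<le> a" "2 * n \<le> b"
  proof -
    have "2 * n * l \<le> a * l" using sa s' nl r1(1) e0 nn zl by linarith
    moreover have "2 * n * l \<le> b * l" using sb s' nl r2(1) e0 nn zl by linarith
    ultimately show "2 * n \<le> a" "2 * n \<le> b" using zl by auto
  qed
  \<comment> \<open>Of these copies, \<open>e\<close> just before and \<open>e'\<close> just after
    half time are exchanged for walks from \<open>i\<close> to \<open>w\<close> and back, which puts
    \<open>w\<close> at half time.\<close>
  have main: "R1 * R2 * Fin (real ((a + b - e - e') * l) * \<mu>) * (B (e * l) i w * B (e' * l) w i)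
      \<le> B s x w * B s w y" if "e \<le> 2 * n" "e' \<le> 2 * n" "w < n" for e e' w
  proof -
    have "R1 * (Fin (real ((a - e) * l) * \<mu>) * B (e * l) i w)
        \<le> B (r1 + e0) x i * (B ((a - e) * l) i i * B (e * l) i w)"
      by (intro trop_mult_mono L powi order_refl)
    also have "\<dots> \<le> B (r1 + e0) x i * B ((a - e) * l + e * l) i w"
      by (intro trop_mult_mono B_add_ge xyi that order_refl)
    also have "\<dots> \<le> B (r1 + e0 + ((a - e) * l + e * l)) x w" by (intro B_add_ge xyi that)
    also have "r1 + e0 + ((a - e) * l + e * l) = s"
      using sa ab that by (simp flip: distrib_right)
    finally have 1: "R1 * (Fin (real ((a - e) * l) * \<mu>) * B (e * l) i w) \<le> B s x w" .
    have "(B (e' * l) w i * Fin (real ((b - e') * l) * \<mu>)) * R2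
        \<le> (B (e' * l) w i * B ((b - e') * l) i i) * B (l - e0 + r2) i y"
      by (intro trop_mult_mono R powi order_refl)
    also have "\<dots> \<le> B (e' * l + (b - e') * l) w i * B (l - e0 + r2) i y"
      by (intro trop_mult_mono B_add_ge xyi that order_refl)
    also have "\<dots> \<le> B (e' * l + (b - e') * l + (l - e0 + r2)) w y"
      by (intro B_add_ge xyi that)
    also have "e' * l + (b - e') * l + (l - e0 + r2) = s"
      using sb ab that by (simp flip: distrib_right)
    finally have 2: "(B (e' * l) w i * Fin (real ((b - e') * l) * \<mu>)) * R2 \<le> B s w y" .
    have "(a + b - e - e') * l = (a - e) * l + (b - e') * l"
      using ab that by (simp flip: distrib_right)
    then have "real ((a + b - e - e') * l) = real ((a - e) * l) + real ((b - e') * l)"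
      by (metis of_nat_add)
    then have "Fin (real ((a + b - e - e') * l) * \<mu>)
        = Fin (real ((a - e) * l) * \<mu>) * Fin (real ((b - e') * l) * \<mu>)"
      by (simp add: algebra_simps)
    then show ?thesis using trop_mult_mono[OF 1 2] by (simp only: mult_ac)
  qed
  have split: "Fin (real ((a + b) * l) * \<mu>)
      = Fin (real ((a + b - e - e') * l) * \<mu>) * Fin (real ((e + e') * l) * \<mu>)"
    if "e \<le> 2 * n" "e' \<le> 2 * n" for e e'
  proof -
    have "(a + b) * l = (a + b - e - e') * l + (e + e') * l"
      using ab that by (simp flip: distrib_right)
    then have "real ((a + b) * l) * \<mu> = real ((a + b - e - e') * l) * \<mu> + real ((e + e') * l) * \<mu>"
      by (metis distrib_right of_nat_add)
    then show ?thesis by simp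
  qed
  have cnz: "R1 * R2 * Fin c \<noteq> 0" for c using Rnz by simp
  \<comment> \<open>Comparison with the optimum \<open>V\<close>, followed by cancellation of the
    finite common part.\<close>
  have le: "B (e * l) i w * B (e' * l) w i \<le> Fin (real ((e + e') * l) * \<mu>)"
    if "e \<le> 2 * n" "e' \<le> 2 * n" "w < n" for e e' w
  proof (rule iffD1[OF trop_mult_le_cancel_left[OF cnz]])
    show "R1 * R2 * Fin (real ((a + b - e - e') * l) * \<mu>) * (B (e * l) i w * B (e' * l) w i)
        \<le> R1 * R2 * Fin (real ((a + b - e - e') * l) * \<mu>) * Fin (real ((e + e') * l) * \<mu>)"
      using order_trans[OF order_trans[OF main[OF that] Vmax[OF that(3)]] V2]
      unfolding split[OF that(1,2)] by (simp only: mult.assoc)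
  qed
  have less: "B (e * l) i w * B (e' * l) w i < Fin (real ((e + e') * l) * \<mu>)"
    if "e \<le> 2 * n" "e' \<le> 2 * n" "w < n" "w \<noteq> i" for e e' w
  proof (rule ccontr)
    assume "\<not> ?thesis"
    then have "Fin (real ((e + e') * l) * \<mu>) \<le> B (e * l) i w * B (e' * l) w i" by simp
    then have "R1 * R2 * Fin (real ((a + b - e - e') * l) * \<mu>) * Fin (real ((e + e') * l) * \<mu>)
        \<le> B s x w * B s w y"
      using order_trans[OF trop_mult_mono[OF order_refl] main[OF that(1-3)]] by blast
    then have "V \<le> B s x w * B s w y"
      using order_trans[OF V2[unfolded split[OF that(1,2)], folded mult.assoc]] by blast
    then show False using Vforced that by blast
  qed
  have "B l i i = Fin (real l * \<mu>)"
    using Bi le[of 1 0 i] xyi n_pos by (simp add: B_0 del: pow_mat.simps)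
  then show ?thesis using that[of l \<mu>] zl le less by blast
qed

end

section \<open>Factor rank of powers of singular matrices\<close>

lemma sum_periodic:
  fixes g :: "nat \<Rightarrow> real"
  assumes "\<And>k. g (k + d) = g k"
  shows "(\<Sum>k<m * d. g k) = real m * (\<Sum>k<d. g k)"
proof (induction m)
  case (Suc m)
  have shift: "g (k + c * d) = g k" for k c
  proof (induction c)
    case (Suc c)
    have "k + Suc c * d = (k + c * d) + d" by simp
    then show ?case using assms Suc by metis
  qed simp
  have split: "(\<Sum>k<a + c. g k) = (\<Sum>k<a. g k) + (\<Sum>k<c. g (k + a))" for a c
    by (induction c) (simp_all add: add_ac)
  have "Suc m * d = m * d + d" by simp
  then show ?case using split[of "m * d" d] Suc by (simp only: shift) (simp add: algebra_simps)
qed simp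

lemma permutes_funpow: "\<pi> permutes S \<Longrightarrow> (\<pi> ^^ k) permutes S"
  by (induction k) (auto simp: permutes_id intro: permutes_compose simp flip: id_def)

lemma orbit_period:
  assumes "\<pi> permutes {..<n}" "i < n"
  obtains d where "1 \<le> d" "d \<le> n" "(\<pi> ^^ d) i = i"
proof -
  have perm: "(\<pi> ^^ k) permutes {..<n}" for k
    using assms(1) by (rule permutes_funpow)
  have lt: "(\<pi> ^^ k) i < n" for k using permutes_in_image[OF perm] assms(2) by auto
  have "\<not> inj_on (\<lambda>k. (\<pi> ^^ k) i) {..n}"
  proof (rule pigeonhole)
    have "card ((\<lambda>k. (\<pi> ^^ k) i) ` {..n}) \<le> card {..<n}"
      using lt by (intro card_mono) auto
    then show "card ((\<lambda>k. (\<pi> ^^ k) i) ` {..n}) < card {..n}" by simp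
  qed
  then obtain p q where pq: "p < q" "q \<le> n" "(\<pi> ^^ p) i = (\<pi> ^^ q) i"
    unfolding inj_on_def by (metis atMost_iff linorder_neqE_nat)
  have "(\<pi> ^^ p) ((\<pi> ^^ (q - p)) i) = (\<pi> ^^ p) i"
    using pq funpow_add[of p "q - p" \<pi>] by simp
  then have "(\<pi> ^^ (q - p)) i = i" using permutes_inj[OF perm] by (auto dest: injD)
  then show ?thesis using that[of "q - p"] pq by auto
qed

lemma funpow_periodic: "(\<pi> ^^ d) i = i \<Longrightarrow> (\<pi> ^^ (k + d)) i = (\<pi> ^^ k) i"
  by (simp add: funpow_add)

text \<open>\<open>fact n\<close> is a common multiple of all possible periods, so orbits of
  different lengths can be compared over one time span.\<close>

lemma sum_orbit_fact:
  fixes b :: "nat \<Rightarrow> real"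
  assumes "1 \<le> d" "d \<le> n" "(\<pi> ^^ d) i = i"
  shows "(\<Sum>k<fact n. b ((\<pi> ^^ k) i)) = (fact n / real d) * (\<Sum>k<d. b ((\<pi> ^^ k) i))"
proof -
  obtain m where m: "fact n = m * d"
    using dvd_fact[OF assms(1,2)] by (metis dvdE mult.commute)
  have "(\<Sum>k<m * d. b ((\<pi> ^^ k) i)) = real m * (\<Sum>k<d. b ((\<pi> ^^ k) i))"
    using assms(3) by (intro sum_periodic) (simp add: funpow_periodic)
  moreover have "fact n = real m * real d" using m by (metis of_nat_fact of_nat_mult)
  then have "fact n / real d = real m" using assms(1) by simp
  ultimately show ?thesis using m by simp
qed

lemma sum_all_orbits:
  fixes b :: "nat \<Rightarrow> real"
  assumes "\<pi> permutes {..<n}"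
  shows "(\<Sum>i<n. \<Sum>k<K. b ((\<pi> ^^ k) i)) = real K * (\<Sum>i<n. b i)"
proof -
  have "(\<Sum>i<n. b ((\<pi> ^^ k) i)) = (\<Sum>i<n. b i)" for k
    using sum.permute[OF permutes_funpow[OF assms], of b k] by (simp add: comp_def)
  then show ?thesis by (subst sum.swap) simp
qed

text \<open>The assumptions are the conclusion of \<open>forced_midpoint\<close> at every vertex.\<close>

locale rigid_matrix = tropical_matrix +
  fixes L :: "nat \<Rightarrow> nat" and mean :: "nat \<Rightarrow> real"
  assumes L_pos: "i < n \<Longrightarrow> 1 \<le> L i" and L_le: "i < n \<Longrightarrow> L i \<le> n"
    and B_L: "i < n \<Longrightarrow> B (L i) i i = Fin (real (L i) * mean i)"
    and forced_le: "i < n \<Longrightarrow> e \<le> 2 * n \<Longrightarrow> e' \<le> 2 * n \<Longrightarrow> k < n \<Longrightarrow>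
       B (e * L i) i k * B (e' * L i) k i \<le> Fin (real ((e + e') * L i) * mean i)"
    and forced_less: "i < n \<Longrightarrow> e \<le> 2 * n \<Longrightarrow> e' \<le> 2 * n \<Longrightarrow> k < n \<Longrightarrow> k \<noteq> i \<Longrightarrow>
       B (e * L i) i k * B (e' * L i) k i < Fin (real ((e + e') * L i) * mean i)"
begin

text \<open>Repeating a closed walk \<open>L i\<close> times makes its length a multiple of
  \<open>L i\<close>, so that \<open>forced_le\<close> applies with \<open>e' = 0\<close>.\<close>

lemma closed_le:
  assumes "i < n" "d \<le> 2 * n"
  shows "B d i i \<le> Fin (real d * mean i)"
proof (cases "B d i i")
  case (Fin r)
  have "B d i i ^ L i \<le> B (d * L i) i i"
    using B_power[OF assms(1), of d "L i"] by (simp add: mult.commute)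
  also have "\<dots> \<le> Fin (real (d * L i) * mean i)"
    using forced_le[OF assms, of 0 i] assms by (simp add: B_0 del: pow_mat.simps)
  finally have "real (L i) * r \<le> real (L i) * (real d * mean i)"
    unfolding Fin Fin_power by (simp add: mult_ac)
  then show ?thesis using L_pos[OF assms(1)] Fin by simp
qed simp

section \<open>Edges on closed walks of maximal mean\<close>

definition tight :: "nat \<Rightarrow> nat \<Rightarrow> bool" where
  "tight i j \<longleftrightarrow> j < n \<and> (\<exists>d<n. A $$ (i, j) * B d j i = Fin (real (Suc d) * mean i))"

lemma B_Suc_ge: "x < n \<Longrightarrow> y < n \<Longrightarrow> z < n \<Longrightarrow> A $$ (x, z) * B d z y \<le> B (Suc d) x y"
  using B_add_ge[of x y z 1 d] by (simp add: B_1 del: pow_mat.simps)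

lemma B_Suc_ge': "x < n \<Longrightarrow> y < n \<Longrightarrow> z < n \<Longrightarrow> B d x z * A $$ (z, y) \<le> B (Suc d) x y"
  using B_add_ge[of x y z d 1] by (simp add: B_1 del: pow_mat.simps)

text \<open>Rotated, the closed walk through the edge starts at \<open>j\<close>, so the mean at
  \<open>j\<close> is no smaller. Conversely, a best cycle at \<open>j\<close> can be inserted into
  it, which would raise the mean at \<open>i\<close> if the one at \<open>j\<close> were
  larger.\<close>

lemma tight_mean_eq:
  assumes i: "i < n" and "tight i j"
  shows "mean j = mean i"
proof -
  obtain d where d: "j < n" "d < n" "A $$ (i, j) * B d j i = Fin (real (Suc d) * mean i)"
    using assms(2) by (auto simp: tight_def)
  have "B d j i * A $$ (i, j) \<le> Fin (real (Suc d) * mean j)"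
    using order_trans[OF B_Suc_ge'[OF d(1,1) i] closed_le[OF d(1)]] d(2) by simp
  then have "real (Suc d) * mean i \<le> real (Suc d) * mean j"
    using d(3) by (simp add: mult.commute)
  then have "mean i \<le> mean j" by simp
  moreover have "A $$ (i, j) * (B (L j) j j * B d j i) \<le> Fin (real (Suc (L j + d)) * mean i)"
  proof -
    have "A $$ (i, j) * (B (L j) j j * B d j i) \<le> A $$ (i, j) * B (L j + d) j i"
      by (intro trop_mult_mono B_add_ge d i order_refl)
    also have "\<dots> \<le> B (Suc (L j + d)) i i" by (intro B_Suc_ge d i)
    \<comment> \<open>\<open>L j\<close> and \<open>Suc d\<close> are at most \<open>n\<close> each,
      which keeps the length within the range \<open>2 * n\<close> of
      \<open>closed_le\<close>.\<close>
    also have "\<dots> \<le> Fin (real (Suc (L j + d)) * mean i)"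
      using L_le[OF d(1)] d(2) by (intro closed_le i) simp
    finally show ?thesis .
  qed
  then have "B (L j) j j * (A $$ (i, j) * B d j i) \<le> Fin (real (Suc (L j + d)) * mean i)"
    by (simp add: mult_ac)
  then have "real (L j) * mean j \<le> real (L j) * mean i"
    unfolding d(3) B_L[OF d(1)] by (simp add: algebra_simps)
  then have "mean j \<le> mean i" using L_pos[OF d(1)] by simp
  ultimately show ?thesis by simp
qed

text \<open>Two best closed walks at \<open>i\<close>, with first edges to \<open>j\<close> and
  \<open>j'\<close>, exchange these edges: one then leads from \<open>j\<close> through
  \<open>i\<close> to \<open>j'\<close>, the other from \<open>j'\<close> through \<open>i\<close>
  to \<open>j\<close>. Together they form a closed walk at \<open>j\<close> of optimal mean that
  visits \<open>j'\<close>. Padding with closed walks at \<open>j\<close> makes both arcs multiples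
  of \<open>L j\<close>, contradicting \<open>forced_less\<close> at \<open>j\<close>.\<close>

lemma tight_unique:
  assumes i: "i < n" and "tight i j" "tight i j'"
  shows "j' = j"
proof (rule ccontr)
  assume ne: "j' \<noteq> j"
  obtain p where p: "j < n" "p < n" "A $$ (i, j) * B p j i = Fin (real (Suc p) * mean i)"
    using assms(2) by (auto simp: tight_def)
  obtain p' where p': "j' < n" "p' < n" "A $$ (i, j') * B p' j' i = Fin (real (Suc p') * mean i)"
    using assms(3) by (auto simp: tight_def)
  define d d' where "d = Suc p" and "d' = Suc p'"
  obtain m where m: "L j = Suc m" using L_pos[OF p(1)] by (cases "L j") auto
  have mean: "mean j = mean i" by (rule tight_mean_eq[OF i assms(2)])
  have there: "B p j i * A $$ (i, j') \<le> B d j j'"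
    unfolding d_def by (intro B_Suc_ge' p p' i)
  have return: "B p' j' i * A $$ (i, j) \<le> B d' j' j"
    unfolding d'_def by (intro B_Suc_ge' p p' i)
  have loop: "Fin (real d * mean i) \<le> B d j j"
    using B_Suc_ge'[OF p(1,1) i, of p] p(3) by (simp add: d_def mult.commute)
  have both: "B p j i * A $$ (i, j') * (B p' j' i * A $$ (i, j)) = Fin (real (d + d') * mean i)"
  proof -
    have "B p j i * A $$ (i, j') * (B p' j' i * A $$ (i, j))
        = (A $$ (i, j) * B p j i) * (A $$ (i, j') * B p' j' i)" by (simp only: mult_ac)
    also have "\<dots> = Fin (real (d + d') * mean i)"
      unfolding p(3) p'(3) d_def d'_def by (simp add: algebra_simps)
    finally show ?thesis .
  qed
  have long: "Fin (real (d + d') * mean i) \<le> B (d + d') j j"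
    unfolding both[symmetric]
    by (rule order_trans[OF trop_mult_mono[OF there return] B_add_ge]) (use p p' in auto)
  \<comment> \<open>The arc of length \<open>d\<close> is preceded by \<open>L j - 1\<close> loops
    of length \<open>d\<close>.\<close>
  have 1: "Fin (real d * mean i) ^ m * (B p j i * A $$ (i, j')) \<le> B (d * L j) j j'"
  proof -
    have "Fin (real d * mean i) ^ m * (B p j i * A $$ (i, j')) \<le> B (m * d) j j * B d j j'"
      by (intro trop_mult_mono there order_trans[OF trop_power_mono[OF loop] B_power[OF p(1)]])
    also have "\<dots> \<le> B (m * d + d) j j'" by (intro B_add_ge p p')
    finally show ?thesis by (simp add: m mult.commute add.commute)
  qed
  \<comment> \<open>The way back has length \<open>d'\<close>; it is followed by
    \<open>L j - 1\<close> closed walks of length \<open>d + d'\<close> and one loop of length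
    \<open>d\<close>.\<close>
  have 2: "B p' j' i * A $$ (i, j) * (Fin (real (d + d') * mean i) ^ m * Fin (real d * mean i))
      \<le> B ((d + d') * L j) j' j"
  proof -
    have "Fin (real (d + d') * mean i) ^ m * Fin (real d * mean i) \<le> B (m * (d + d')) j j * B d j j"
      by (intro trop_mult_mono loop order_trans[OF trop_power_mono[OF long] B_power[OF p(1)]])
    also have "\<dots> \<le> B (m * (d + d') + d) j j" by (intro B_add_ge p)
    finally have "B p' j' i * A $$ (i, j) * (Fin (real (d + d') * mean i) ^ m * Fin (real d * mean i))
        \<le> B d' j' j * B (m * (d + d') + d) j j" by (intro trop_mult_mono return)
    also have "\<dots> \<le> B (d' + (m * (d + d') + d)) j' j" by (intro B_add_ge p p')
    also have "d' + (m * (d + d') + d) = (d + d') * L j" by (simp add: m algebra_simps)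
    finally show ?thesis .
  qed
  have "Fin (real ((d + (d + d')) * L j) * mean j)
      = Fin (real d * mean i) ^ m * (Fin (real (d + d') * mean i) ^ m * Fin (real d * mean i))
        * Fin (real (d + d') * mean i)"
    unfolding mean m Fin_power by (simp add: algebra_simps)
  also have "\<dots> \<le> B (d * L j) j j' * B ((d + d') * L j) j' j"
    using trop_mult_mono[OF 1 2] unfolding both[symmetric] by (simp only: mult_ac)
  also have "\<dots> < Fin (real ((d + (d + d')) * L j) * mean j)"
    using p(2) p'(2) by (intro forced_less p(1) p'(1) ne) (auto simp: d_def d'_def)
  finally show False by simp
qed

lemma closed_tight:
  assumes "i < n" "d < n" "j < n" "Fin (real (Suc d) * mean i) \<le> A $$ (i, j) * B d j i"
  shows "tight i j"
proof -
  have "A $$ (i, j) * B d j i \<le> Fin (real (Suc d) * mean i)"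
    using order_trans[OF B_Suc_ge[OF assms(1,1,3)] closed_le[OF assms(1)]] assms(2) by simp
  then show ?thesis using assms unfolding tight_def by (metis order_antisym)
qed

definition \<sigma> :: "nat \<Rightarrow> nat" where
  "\<sigma> i = (if i < n then SOME j. tight i j else i)"

lemma tight_exists: assumes "i < n" shows "tight i (\<sigma> i)"
proof -
  obtain m where m: "L i = Suc m" using L_pos[OF assms] by (cases "L i") auto
  obtain j where "j < n" "B (1 + m) i i = B 1 i j * B m j i"
    using B_add_attained[OF assms assms] by blast
  then have "tight i j"
    using B_L[OF assms] L_le[OF assms] assms m
    by (intro closed_tight[of i m]) (auto simp: B_1 simp del: pow_mat.simps)
  then have "tight i (SOME j. tight i j)" by (rule someI)
  then show ?thesis using assms by (simp add: \<sigma>_def)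
qed

lemma tight_iff: "i < n \<Longrightarrow> tight i j \<longleftrightarrow> j = \<sigma> i"
  using tight_unique tight_exists by blast

lemma \<sigma>_less [simp]: "i < n \<Longrightarrow> \<sigma> i < n"
  using tight_exists by (auto simp: tight_def)

lemma \<sigma>_pow_less [simp]: "i < n \<Longrightarrow> (\<sigma> ^^ k) i < n"
  by (induction k) auto

lemma mean_\<sigma>_pow: "i < n \<Longrightarrow> mean ((\<sigma> ^^ k) i) = mean i"
proof (induction k)
  case (Suc k)
  then show ?case using tight_mean_eq[OF \<sigma>_pow_less tight_exists[OF \<sigma>_pow_less]] by simp
qed simp

text \<open>A best closed walk that has followed \<open>\<sigma>\<close> for \<open>k\<close> steps
  can be rotated to its current vertex, where it again has optimal mean. Its next edge is therefore
  tight, hence the edge of \<open>\<sigma>\<close>.\<close>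

lemma best_cycle_follows_\<sigma>:
  assumes i: "i < n" and "k \<le> L i"
  shows "Fin (real (L i) * mean i) \<le> weight (\<lambda>t. (\<sigma> ^^ t) i) 0 k * B (L i - k) ((\<sigma> ^^ k) i) i"
  using assms(2)
proof (induction k)
  case 0
  then show ?case using B_L[OF i] by simp
next
  case (Suc k)
  let ?f = "\<lambda>t. (\<sigma> ^^ t) i" and ?c = "(\<sigma> ^^ k) i"
  have c: "?c < n" using i by simp
  obtain d where d: "L i - k = 1 + d" using Suc.prems by (metis Suc_diff_le diff_Suc_Suc plus_1_eq_Suc)
  have len: "L i = Suc (d + k)" using d Suc.prems by simp
  obtain j where j: "j < n" "B (L i - k) ?c i = A $$ (?c, j) * B d j i"
    using B_add_attained[OF c i, of 1 d] unfolding d by (auto simp: B_1 c simp del: pow_mat.simps)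
  have IH: "Fin (real (L i) * mean i) \<le> weight ?f 0 k * (A $$ (?c, j) * B d j i)"
    using Suc unfolding j(2)[symmetric] by simp
  also have "\<dots> \<le> A $$ (?c, j) * (B d j i * B k i ?c)"
    using weight_le[of ?f 0 k] i by (auto simp: mult_ac intro!: trop_mult_mono)
  also have "\<dots> \<le> A $$ (?c, j) * B (d + k) j ?c"
    by (intro trop_mult_mono B_add_ge i c j order_refl)
  finally have "tight ?c j"
    using d L_le[OF i] Suc.prems len by (intro closed_tight[of _ "d + k"] c j) (auto simp: mean_\<sigma>_pow i)
  then have "j = \<sigma> ?c" using tight_iff[OF c] by simp
  moreover have "L i - Suc k = d" using d by simp
  ultimately show ?case using IH by (simp add: weight_Suc mult_ac del: pow_mat.simps)
qed

text \<open>After \<open>L i\<close> steps the remaining factor is an entry of \<open>B 0\<close>,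
  which is finite only on the diagonal.\<close>

lemma \<sigma>_period: assumes "i < n" shows "(\<sigma> ^^ L i) i = i"
proof (rule ccontr)
  assume "\<not> ?thesis"
  then show False
    using best_cycle_follows_\<sigma>[OF assms order_refl] assms
    by (simp add: B_0 trop_Fin_not_le_zero del: pow_mat.simps)
qed

lemma \<sigma>_weight:
  assumes "i < n" shows "Fin (real (L i) * mean i) \<le> weight (\<lambda>t. (\<sigma> ^^ t) i) 0 (L i)"
  using best_cycle_follows_\<sigma>[OF assms order_refl] assms \<sigma>_period[OF assms]
  by (simp add: B_0 del: pow_mat.simps)

lemma \<sigma>_permutes: "\<sigma> permutes {..<n}"
proof -
  have "i \<in> \<sigma> ` {..<n}" if i: "i < n" for i
  proof -
    obtain m where "L i = Suc m" using L_pos[OF i] by (cases "L i") auto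
    then have "i = \<sigma> ((\<sigma> ^^ m) i)" using \<sigma>_period[OF i] by simp
    then show ?thesis using i \<sigma>_pow_less by blast
  qed
  then have "{..<n} \<subseteq> \<sigma> ` {..<n}" by auto
  moreover have "\<sigma> ` {..<n} \<subseteq> {..<n}" by auto
  ultimately have "bij_betw \<sigma> {..<n} {..<n}"
    using finite_surj_inj[of "{..<n}" \<sigma>] by (auto simp: bij_betw_def)
  then show ?thesis by (rule bij_imp_permutes) (simp add: \<sigma>_def)
qed

section \<open>Optimality of the permutation \<open>\<sigma>\<close>\<close>

lemma orbit_weight:
  assumes \<rho>: "\<rho> permutes {..<n}" and b: "\<And>i. i < n \<Longrightarrow> A $$ (i, \<rho> i) = Fin (b i)" and i: "i < n"
  shows "weight (\<lambda>t. (\<rho> ^^ t) i) 0 d = Fin (\<Sum>k<d. b ((\<rho> ^^ k) i))"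
proof -
  have "(\<rho> ^^ k) i < n" for k
    using permutes_in_image[OF permutes_funpow[OF \<rho>, of k]] i by auto
  then show ?thesis unfolding weight_def by (simp add: b prod_Fin atLeast0LessThan)
qed

text \<open>An orbit of \<open>\<rho>\<close> is a closed walk, so its mean is at most that at
  \<open>i\<close>. Equality would make its first edge tight, hence the edge of
  \<open>\<sigma>\<close>.\<close>

lemma orbit_sum_le:
  assumes \<rho>: "\<rho> permutes {..<n}" and b: "\<And>i. i < n \<Longrightarrow> A $$ (i, \<rho> i) = Fin (b i)" and i: "i < n"
  shows "(\<Sum>k<fact n. b ((\<rho> ^^ k) i)) \<le> fact n * mean i"
    and "\<rho> i \<noteq> \<sigma> i \<Longrightarrow> (\<Sum>k<fact n. b ((\<rho> ^^ k) i)) < fact n * mean i"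
proof -
  let ?f = "\<lambda>t. (\<rho> ^^ t) i"
  have lt: "?f k < n" for k
    using permutes_in_image[OF permutes_funpow[OF \<rho>, of k]] i by auto
  obtain d where d: "1 \<le> d" "d \<le> n" "(\<rho> ^^ d) i = i" using orbit_period[OF \<rho> i] by blast
  have "weight ?f 0 d \<le> B d i i" using weight_le[of ?f 0 d] lt d by simp
  also have "\<dots> \<le> Fin (real d * mean i)" using d by (intro closed_le i) simp
  finally have le: "(\<Sum>k<d. b (?f k)) \<le> real d * mean i"
    by (simp add: orbit_weight[OF \<rho> b i])
  have eq: "(\<Sum>k<fact n. b (?f k)) = (fact n / real d) * (\<Sum>k<d. b (?f k))"
    by (rule sum_orbit_fact[OF d])
  have "(fact n / real d) * (\<Sum>k<d. b (?f k)) \<le> (fact n / real d) * (real d * mean i)"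
    using le by (intro mult_left_mono) auto
  then show "(\<Sum>k<fact n. b (?f k)) \<le> fact n * mean i" using eq d by simp
  assume ne: "\<rho> i \<noteq> \<sigma> i"
  obtain m where m: "d = Suc m" using d by (cases d) auto
  have "(\<Sum>k<d. b (?f k)) \<noteq> real d * mean i"
  proof
    assume "(\<Sum>k<d. b (?f k)) = real d * mean i"
    then have "Fin (real d * mean i) = weight ?f 0 1 * weight ?f 1 d"
      using weight_split[of 0 1 d ?f] d by (simp add: orbit_weight[OF \<rho> b i])
    also have "\<dots> \<le> A $$ (i, \<rho> i) * B m (\<rho> i) i"
    proof (rule trop_mult_mono)
      show "weight ?f 1 d \<le> B m (\<rho> i) i"
        using weight_le[of ?f 1 d] lt d m by (simp del: pow_mat.simps funpow.simps) simp
    qed (simp add: weight_def)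
    finally have "tight i (\<rho> i)" using closed_tight[of i m "\<rho> i"] lt[of 1] i d m by simp
    then show False using ne tight_iff[OF i] by simp
  qed
  then have "(fact n / real d) * (\<Sum>k<d. b (?f k)) < (fact n / real d) * (real d * mean i)"
    using le d by (intro mult_strict_left_mono) auto
  then show "(\<Sum>k<fact n. b (?f k)) < fact n * mean i" using eq d by simp
qed

text \<open>Averaging the orbit sums over all starting points recovers the weight of a permutation.
  For \<open>\<sigma>\<close> every orbit reaches the mean of its vertices; for another permutation
  none exceeds it and some orbit stays strictly below.\<close>

lemma nonsingular_\<sigma>: "nonsingular n A \<sigma>"
proof -
  have "A $$ (i, \<sigma> i) \<noteq> 0" if "i < n" for i
    using tight_exists[OF that] by (auto simp: tight_def)
  then have "\<exists>r. A $$ (i, \<sigma> i) = Fin r" if "i < n" for i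
    using that by (metis trop_not_zeroE)
  then obtain a where a: "\<And>i. i < n \<Longrightarrow> A $$ (i, \<sigma> i) = Fin (a i)" by metis
  have "fact n * mean i \<le> (\<Sum>k<fact n. a ((\<sigma> ^^ k) i))" if i: "i < n" for i
  proof -
    have le: "real (L i) * mean i \<le> (\<Sum>k<L i. a ((\<sigma> ^^ k) i))"
      using \<sigma>_weight[OF i] by (simp add: orbit_weight[OF \<sigma>_permutes a i])
    have "(fact n / real (L i)) * (real (L i) * mean i)
        \<le> (fact n / real (L i)) * (\<Sum>k<L i. a ((\<sigma> ^^ k) i))"
      using le by (intro mult_left_mono) auto
    then show ?thesis
      using sum_orbit_fact[OF L_pos[OF i] L_le[OF i] \<sigma>_period[OF i], of a] L_pos[OF i] by simp
  qed
  then have "(\<Sum>i<n. fact n * mean i) \<le> (\<Sum>i<n. \<Sum>k<fact n. a ((\<sigma> ^^ k) i))"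
    by (intro sum_mono) auto
  then have sum_\<sigma>: "(\<Sum>i<n. mean i) \<le> (\<Sum>i<n. a i)"
    by (simp add: sum_all_orbits[OF \<sigma>_permutes] flip: sum_distrib_left)
  have w\<sigma>: "perm_weight n A \<sigma> = Fin (\<Sum>i<n. a i)"
    unfolding perm_weight_def by (simp add: a prod_Fin)
  have "perm_weight n A \<rho> < perm_weight n A \<sigma>" if \<rho>: "\<rho> permutes {..<n}" "\<rho> \<noteq> \<sigma>" for \<rho>
  proof (cases "perm_weight n A \<rho> = 0")
    case True
    then show ?thesis by (simp add: w\<sigma> zero_trop_def less_trop_def)
  next
    case False
    then have "\<exists>r. A $$ (i, \<rho> i) = Fin r" if "i < n" for i
      using that by (auto simp: perm_weight_def trop_prod_eq_zero_iff elim: trop_not_zeroE)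
    then obtain b where b: "\<And>i. i < n \<Longrightarrow> A $$ (i, \<rho> i) = Fin (b i)" by metis
    obtain i0 where i0: "i0 < n" "\<rho> i0 \<noteq> \<sigma> i0"
      using \<rho> \<sigma>_permutes by (metis ext lessThan_iff permutes_not_in)
    have "(\<Sum>i<n. \<Sum>k<fact n. b ((\<rho> ^^ k) i)) < (\<Sum>i<n. fact n * mean i)"
      using orbit_sum_le[OF \<rho>(1) b] i0 by (intro sum_strict_mono_ex1) auto
    then have "(\<Sum>i<n. b i) < (\<Sum>i<n. mean i)"
      by (simp add: sum_all_orbits[OF \<rho>(1)] flip: sum_distrib_left)
    moreover have "perm_weight n A \<rho> = Fin (\<Sum>i<n. b i)"
      unfolding perm_weight_def by (simp add: b prod_Fin)
    ultimately show ?thesis using sum_\<sigma> by (simp add: w\<sigma>)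
  qed
  then show ?thesis
    unfolding nonsingular_def using \<sigma>_permutes w\<sigma> by (auto simp: zero_trop_def)
qed

end

text \<open>If one vertex \<open>i\<close> can be avoided at half time for all end points, it may be
  deleted from the middle of \<open>A ^\<^sub>m s * A ^\<^sub>m s\<close>, which leaves inner
  dimension \<open>n - 1\<close>. Otherwise every vertex is forced for some end points, and
  \<open>A\<close> is rigid.\<close>

lemma nonsingular_or_factor:
  assumes A: "A \<in> carrier_mat n n" and n: "2 \<le> n" and s: "4 * n * n \<le> s"
  obtains (nonsingular) \<sigma> where "nonsingular n A \<sigma>"
  | (factor) C D where "C \<in> carrier_mat n (n - 1)" "D \<in> carrier_mat (n - 1) n"
      "A ^\<^sub>m (2 * s) = C * (D :: trop mat)"
proof -
  interpret tropical_matrix n A using A n by unfold_locales auto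
  show ?thesis
  proof (cases "\<exists>i<n. \<forall>x<n. \<forall>y<n. \<exists>k<n. k \<noteq> i \<and> B s x i * B s i y \<le> B s x k * B s k y")
    case True
    then obtain i where i: "i < n"
      "\<And>x y. x < n \<Longrightarrow> y < n \<Longrightarrow> \<exists>k<n. k \<noteq> i \<and> B s x i * B s i y \<le> B s x k * B s k y" by blast
    have "card ({..<n} - {i}) = n - 1" using i by simp
    then obtain e where e: "bij_betw e {..<n - 1} ({..<n} - {i})"
      using ex_bij_betw_nat_finite[of "{..<n} - {i}"] by (auto simp: atLeast0LessThan)
    have en: "e k < n" if "k < n - 1" for k using e that by (auto dest: bij_betwE)
    define C where "C = mat n (n - 1) (\<lambda>(x, k). B s x (e k))"
    define D where "D = mat (n - 1) n (\<lambda>(k, y). B s (e k) y)"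
    have C: "C \<in> carrier_mat n (n - 1)" and D: "D \<in> carrier_mat (n - 1) n"
      by (auto simp: C_def D_def)
    have "A ^\<^sub>m (2 * s) = C * D"
    proof (rule eq_matI)
      fix x y assume "x < dim_row (C * D)" "y < dim_col (C * D)"
      then have xy: "x < n" "y < n" using C D by auto
      show "(A ^\<^sub>m (2 * s)) $$ (x, y) = (C * D) $$ (x, y)"
      proof (rule order_antisym)
        obtain k where k: "k < n" "B (s + s) x y = B s x k * B s k y"
          using B_add_attained[OF xy] by blast
        then obtain k' where k': "k' < n" "k' \<noteq> i" "B (s + s) x y \<le> B s x k' * B s k' y"
          using i(2)[OF xy] by (cases "k = i") auto
        then have "k' \<in> e ` {..<n - 1}" using e by (auto simp: bij_betw_def)
        then obtain j where j: "j < n - 1" "e j = k'" by auto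
        have "C $$ (x, j) * D $$ (j, y) \<le> (C * D) $$ (x, y)"
          by (intro mult_mat_entry_ge[OF C D] xy j)
        then show "B (2 * s) x y \<le> (C * D) $$ (x, y)"
          using k'(3) j xy by (simp add: C_def D_def mult_2)
      next
        obtain j where j: "j < n - 1" "(C * D) $$ (x, y) = C $$ (x, j) * D $$ (j, y)"
          using mult_mat_entry_attained[OF C D xy] n by auto
        then show "(C * D) $$ (x, y) \<le> B (2 * s) x y"
          using B_add_ge[OF xy en[OF j(1)], of s s] xy by (simp add: C_def D_def mult_2)
      qed
    qed (use C D A in auto)
    then show ?thesis using factor[OF C D] by blast
  next
    case False
    then have F: "\<exists>x<n. \<exists>y<n. \<forall>k<n. k \<noteq> i \<longrightarrow> B s x k * B s k y < B s x i * B s i y" if "i < n" for i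
      using that by (meson not_less)
    have "\<exists>l \<mu>. 1 \<le> l \<and> l \<le> n \<and> B l i i = Fin (real l * \<mu>) \<and>
      (\<forall>e e' k. e \<le> 2 * n \<longrightarrow> e' \<le> 2 * n \<longrightarrow> k < n \<longrightarrow>
         B (e * l) i k * B (e' * l) k i \<le> Fin (real ((e + e') * l) * \<mu>) \<and>
         (k \<noteq> i \<longrightarrow> B (e * l) i k * B (e' * l) k i < Fin (real ((e + e') * l) * \<mu>)))"
      if i: "i < n" for i
    proof -
      obtain x y where xy: "x < n" "y < n"
        "\<And>k. k < n \<Longrightarrow> k \<noteq> i \<Longrightarrow> B s x k * B s k y < B s x i * B s i y"
        using F[OF i] by blast
      \<comment> \<open>As \<open>2 \<le> n\<close>, there is another vertex; being strictly better
        than it, the value at \<open>i\<close> is finite.\<close>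
      have "(if i = 0 then 1 else 0) < n" "(if i = 0 then 1 else 0) \<noteq> i" using n by auto
      then obtain k where "k < n" "k \<noteq> i" by blast
      then have "B s x i * B s i y \<noteq> 0" using xy(3) by (metis leD trop_zero_le)
      from forced_midpoint[OF xy(1,2) i s this xy(3)] show ?thesis by metis
    qed
    then obtain L mean where "\<And>i. i < n \<Longrightarrow> 1 \<le> L i \<and> L i \<le> n \<and> B (L i) i i = Fin (real (L i) * mean i) \<and>
      (\<forall>e e' k. e \<le> 2 * n \<longrightarrow> e' \<le> 2 * n \<longrightarrow> k < n \<longrightarrow>
         B (e * L i) i k * B (e' * L i) k i \<le> Fin (real ((e + e') * L i) * mean i) \<and>
         (k \<noteq> i \<longrightarrow> B (e * L i) i k * B (e' * L i) k i < Fin (real ((e + e') * L i) * mean i)))"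
      by metis
    then interpret rigid_matrix n A L mean by unfold_locales auto
    show ?thesis using nonsingular[OF nonsingular_\<sigma>] .
  qed
qed

section \<open>Words in two matrices with equal diagonals\<close>

definition letter_mat :: "trop mat \<Rightarrow> trop mat \<Rightarrow> letter \<Rightarrow> trop mat" where
  "letter_mat X Y l = (case l of La \<Rightarrow> X | Lb \<Rightarrow> Y)"

definition word_mat :: "nat \<Rightarrow> trop mat \<Rightarrow> trop mat \<Rightarrow> letter list \<Rightarrow> trop mat" where
  "word_mat n X Y w = foldr (\<lambda>l M. letter_mat X Y l * M) w (1\<^sub>m n)"

lemma word_mat_simps [simp]:
  "word_mat n X Y [] = 1\<^sub>m n"
  "word_mat n X Y (l # w) = letter_mat X Y l * word_mat n X Y w"
  by (simp_all add: word_mat_def)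

definition subst_word :: "letter list \<Rightarrow> letter list \<Rightarrow> letter list \<Rightarrow> letter list" where
  "subst_word p q w = concat (map (\<lambda>l. case l of La \<Rightarrow> p | Lb \<Rightarrow> q) w)"

lemma subst_word_simps [simp]:
  "subst_word p q [] = []"
  "subst_word p q (l # w) = (case l of La \<Rightarrow> p | Lb \<Rightarrow> q) @ subst_word p q w"
  "subst_word p q (v @ w) = subst_word p q v @ subst_word p q w"
  by (simp_all add: subst_word_def)

lemma length_subst_word: "length p = length q \<Longrightarrow> length (subst_word p q w) = length w * length p"
  by (induction w) (auto split: letter.split)

lemma subst_word_inj:
  assumes "length p = length q" "p \<noteq> q" "length u = length v" "subst_word p q u = subst_word p q v"
  shows "u = v"
  using assms(3,4)
proof (induction u v rule: list_induct2)
  case (Cons k u l v)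
  let ?s = "\<lambda>l. case l of La \<Rightarrow> p | Lb \<Rightarrow> q"
  have "length (?s k) = length (?s l)" using assms(1) by (auto split: letter.split)
  then have "?s k = ?s l" "subst_word p q u = subst_word p q v" using Cons.prems by auto
  then show ?case using Cons.IH assms(2) by (auto split: letter.splits)
qed simp

locale matrix_pair =
  fixes n :: nat and X Y :: "trop mat"
  assumes X [simp]: "X \<in> carrier_mat n n" and Y [simp]: "Y \<in> carrier_mat n n"
begin

lemma letter_carrier [simp]: "letter_mat X Y l \<in> carrier_mat n n"
  by (simp add: letter_mat_def split: letter.split)

lemma word_carrier [simp]: "word_mat n X Y w \<in> carrier_mat n n"
  by (induction w) (auto intro: mult_carrier_mat[of _ n n _ n])

lemma word_mat_append: "word_mat n X Y (v @ w) = word_mat n X Y v * word_mat n X Y w"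
proof (induction v)
  case Nil
  show ?case using left_mult_one_mat[OF word_carrier] by simp
next
  case (Cons l v)
  then show ?case using assoc_mult_mat[OF letter_carrier word_carrier word_carrier] by simp
qed

lemma word_mat_single: "word_mat n X Y [l] = letter_mat X Y l"
  using right_mult_one_mat[OF letter_carrier] by simp

lemma word_mat_subst:
  "word_mat n X Y (subst_word p q w) = word_mat n (word_mat n X Y p) (word_mat n X Y q) w"
  by (induction w) (auto simp: word_mat_append letter_mat_def split: letter.split)

lemma word_mat_replicate: "word_mat n X Y (concat (replicate k w)) = word_mat n X Y w ^\<^sub>m k"
proof (induction k)
  case (Suc k)
  have "concat (replicate (Suc k) w) = concat (replicate k w) @ w"
    by (simp flip: replicate_append_same)
  then show ?case using Suc by (simp add: word_mat_append)
qed (simp add: carrier_matD[OF word_carrier])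

end

lemma word_mat_same: "word_mat n Z Z u = word_mat n Z Z (replicate (length u) La)"
  by (induction u) (auto simp: letter_mat_def split: letter.split)

section \<open>Moving the jumps of a walk along a word\<close>

lemma suffix_sum_bound:
  fixes h t :: "nat \<Rightarrow> real"
  assumes t: "\<And>r. r < k \<Longrightarrow> 0 \<le> t r \<and> t r \<le> D" "\<And>r. Suc r < k \<Longrightarrow> t r \<le> t (Suc r)"
    and D: "0 \<le> D" and G: "\<And>j. j \<le> k \<Longrightarrow> (\<Sum>r=j..<k. h r) \<le> G"
  shows "(\<Sum>r<k. h r * t r) \<le> D * G"
proof (cases k)
  case 0
  then show ?thesis using G[of 0] D by simp
next
  case (Suc m)
  \<comment> \<open>Summation by parts: the increments of \<open>t\<close> are nonnegative
    coefficients of the suffix sums of \<open>h\<close>. The remaining amount \<open>D - t j\<close>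
    is charged to \<open>G\<close>, which is nonnegative as a bound of the empty sum.\<close>
  have "(\<Sum>r=j..<k. h r * t r) \<le> t j * (\<Sum>r=j..<k. h r) + (D - t j) * G" if "j \<le> m" for j
    using that
  proof (induction rule: inc_induct)
    case base
    have "0 \<le> (D - t m) * G" using t(1)[of m] G[of k] Suc by (intro mult_nonneg_nonneg) auto
    then show ?case by (simp add: Suc mult.commute)
  next
    case (step j)
    let ?S = "\<Sum>r=Suc j..<k. h r"
    have jk: "j < k" using step Suc by simp
    have "(t (Suc j) - t j) * ?S \<le> (t (Suc j) - t j) * G"
      using t(2)[of j] G[of "Suc j"] step Suc by (intro mult_left_mono) auto
    then show ?case using step.IH by (simp add: sum.atLeast_Suc_lessThan[OF jk] algebra_simps)
  qed
  from this[of 0] have "(\<Sum>r<k. h r * t r) \<le> t 0 * (\<Sum>r=0..<k. h r) + (D - t 0) * G"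
    by (simp add: atLeast0LessThan)
  also have "\<dots> \<le> t 0 * G + (D - t 0) * G"
    using t(1)[of 0] G[of 0] Suc by (intro add_right_mono mult_left_mono) auto
  finally show ?thesis by (simp add: algebra_simps)
qed

definition universal :: "nat \<Rightarrow> letter list \<Rightarrow> bool" where
  "universal n q \<longleftrightarrow> (\<forall>z. length z \<le> n \<longrightarrow>
     (\<exists>a. a + length z \<le> length q \<and> (\<forall>r<length z. q ! (a + r) = z ! r)))"

text \<open>The pattern of jump letters occurs contiguously in both copies of \<open>q\<close>. As the weight is
  linear in the shifts \<open>\<tau> r - r\<close>, and these are monotone in \<open>r\<close>, all jumps strictly between the
  two occurrences can be moved, the earlier ones to the left occurrence and the later ones to
  the right one, without decreasing the weight. After that no jump reads the middle letter.\<close>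

lemma move_jumps:
  fixes g :: "nat \<Rightarrow> real" and \<tau> :: "nat \<Rightarrow> nat"
  assumes q: "universal n q" and k: "k \<le> n"
    and \<tau>: "\<And>r. Suc r < k \<Longrightarrow> \<tau> r < \<tau> (Suc r)"
    and T: "\<And>r. r < k \<Longrightarrow> \<tau> r < 2 * length q + 1"
  obtains \<tau>' where "\<And>r. Suc r < k \<Longrightarrow> \<tau>' r < \<tau>' (Suc r)"
    "\<And>r. r < k \<Longrightarrow> \<tau>' r < 2 * length q + 1"
    "\<And>r. r < k \<Longrightarrow> (q @ [l'] @ q) ! \<tau>' r = (q @ [l] @ q) ! \<tau> r"
    "(\<Sum>r<k. g r * real (\<tau> r)) \<le> (\<Sum>r<k. g r * real (\<tau>' r))"
proof -
  define N where "N = length q"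
  define z where "z = map (\<lambda>r. (q @ [l] @ q) ! \<tau> r) [0..<k]"
  obtain a where a: "a + k \<le> N" "\<And>r. r < k \<Longrightarrow> q ! (a + r) = (q @ [l] @ q) ! \<tau> r"
    using q k unfolding universal_def N_def by (metis (no_types, lifting) z_def length_map
        length_upt minus_nat.diff_0 nth_map_upt add_0)
  \<comment> \<open>The same occurrence in the second copy of \<open>q\<close>, behind the middle
    letter.\<close>
  define b where "b = N + 1 + a"
  have ab: "a < b" by (simp add: b_def)
  have \<tau>_ge: "r \<le> \<tau> r" if "r < k" for r
    using that
  proof (induction r)
    case (Suc r)
    then show ?case using \<tau>[of r] by simp
  qed simp
  \<comment> \<open>\<open>s r\<close> is where the pattern would start if jump \<open>r\<close> had
    its proper place in it. The values \<open>a\<close> and \<open>b\<close> stand for the two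
    occurrences.\<close>
  define s where "s r = \<tau> r - r" for r
  have \<tau>_s: "\<tau> r = s r + r" if "r < k" for r using \<tau>_ge[OF that] by (simp add: s_def)
  have s_mono: "s r \<le> s (Suc r)" if "Suc r < k" for r
    using \<tau>[OF that] \<tau>_s[of r] \<tau>_s[of "Suc r"] that by simp
  define mid where "mid r \<longleftrightarrow> a < s r \<and> s r < b" for r
  define h where "h r = (if mid r then g r else 0)" for r
  \<comment> \<open>Clamped at both ends so that \<open>t\<close> is monotone and at most
    \<open>b - a\<close>, as \<open>suffix_sum_bound\<close> asks; beyond the ends \<open>h\<close>
    is zero.\<close>
  define t where "t r = real (if s r \<le> a then 0 else if b \<le> s r then b - a else s r - a)" for r
  \<comment> \<open>Sending the middle jumps from \<open>j\<close> on to the right and the earlier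
    ones to the left gains \<open>(b - a) * suf j\<close> minus a sum independent of
    \<open>j\<close>, so a maximizer of \<open>suf\<close> is chosen.\<close>
  define suf where "suf j = (\<Sum>r=j..<k. h r)" for j
  have "Max (suf ` {..k}) \<in> suf ` {..k}" by (intro Max_in) auto
  then obtain j where j: "j \<le> k" "Max (suf ` {..k}) = suf j" by (metis imageE atMost_iff)
  have suf_le: "suf i \<le> suf j" if "i \<le> k" for i
    unfolding j(2)[symmetric] using that by (intro Max_ge) auto
  define s' where "s' r = (if mid r then if r < j then a else b else s r)" for r
  define \<tau>' where "\<tau>' r = s' r + r" for r
  have s'_mono: "s' r \<le> s' (Suc r)" if "Suc r < k" for r
    using s_mono[OF that] ab by (auto simp: s'_def mid_def)
  have nth: "(q @ l'' # q) ! p = (if p < N then q ! p else q ! (p - N - 1))" if "p \<noteq> N" for l'' p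
    using that by (auto simp: nth_append nth_Cons' N_def)
  have bnd: "\<tau>' r < 2 * N + 1" if "r < k" for r
    using T[OF that] \<tau>_s[OF that] a(1) that by (auto simp: \<tau>'_def s'_def b_def N_def)
  have letter: "(q @ [l'] @ q) ! \<tau>' r = (q @ [l] @ q) ! \<tau> r" if r: "r < k" for r
  proof (cases "mid r")
    case False
    \<comment> \<open>A shift of at most \<open>a\<close> keeps the jump inside the first copy, by
      \<open>a + k \<le> N\<close>; one of at least \<open>b\<close> puts it beyond the middle
      letter.\<close>
    then have "\<tau>' r = \<tau> r" "\<tau> r \<noteq> N"
      using \<tau>_s[OF r] a(1) r by (auto simp: \<tau>'_def s'_def mid_def b_def)
    then show ?thesis using nth[where p = "\<tau> r" and l'' = l] nth[where p = "\<tau> r" and l'' = l'] by simp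
  next
    case True
    then have "\<tau>' r = a + r \<or> \<tau>' r = N + 1 + (a + r)"
      by (auto simp: \<tau>'_def s'_def b_def)
    then show ?thesis using a r by (auto simp: nth)
  qed
  have "(\<Sum>r<k. h r * t r) \<le> (real b - real a) * suf j"
  proof (rule suffix_sum_bound)
    show "0 \<le> t r \<and> t r \<le> real b - real a" for r
      using ab by (auto simp: t_def)
    show "t r \<le> t (Suc r)" if "Suc r < k" for r
      using s_mono[OF that] ab by (auto simp: t_def)
  qed (use ab suf_le in \<open>auto simp: suf_def\<close>)
  moreover have "(\<Sum>r<k. g r * (real (\<tau>' r) - real (\<tau> r)))
      = (\<Sum>r<k. (if j \<le> r then h r * (real b - real a) else 0) - h r * t r)"
    using \<tau>_s by (intro sum.cong) (auto simp: \<tau>'_def s'_def h_def t_def mid_def algebra_simps)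
  moreover have "(\<Sum>r<k. if j \<le> r then h r * (real b - real a) else 0) = (real b - real a) * suf j"
  proof -
    have "(\<Sum>r<k. if j \<le> r then h r * (real b - real a) else 0)
        = (\<Sum>r\<in>{r \<in> {..<k}. j \<le> r}. h r * (real b - real a))"
      by (rule sum.inter_filter[symmetric]) simp
    also have "{r \<in> {..<k}. j \<le> r} = {j..<k}" by auto
    finally show ?thesis by (simp add: suf_def sum_distrib_left mult.commute)
  qed
  ultimately have "0 \<le> (\<Sum>r<k. g r * (real (\<tau>' r) - real (\<tau> r)))"
    by (simp add: sum_subtractf)
  then have "(\<Sum>r<k. g r * real (\<tau> r)) \<le> (\<Sum>r<k. g r * real (\<tau>' r))"
    by (simp add: right_diff_distrib sum_subtractf)
  then show ?thesis using that[of \<tau>'] s'_mono bnd letter by (force simp: \<tau>'_def N_def)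
qed

lemma strict_chain:
  fixes \<tau> :: "nat \<Rightarrow> nat"
  assumes "\<And>r. Suc r < k \<Longrightarrow> \<tau> r < \<tau> (Suc r)" "r < s" "s < k"
  shows "\<tau> r < \<tau> s"
  using assms(2,3)
proof (induction s)
  case (Suc s)
  then show ?case using assms(1)[of s] by (cases "r = s") auto
qed simp

section \<open>Walks along a word for two matrices with the same diagonal\<close>

locale equal_diagonal_pair = matrix_pair +
  fixes f :: "nat \<Rightarrow> real"
  assumes n_pos: "0 < n" and diag: "\<And>l i. i < n \<Longrightarrow> letter_mat X Y l $$ (i, i) = Fin (f i)"
begin

abbreviation "M \<equiv> letter_mat X Y"
abbreviation "E \<equiv> word_mat n X Y"

lemma E_append_ge:
  "i < n \<Longrightarrow> j < n \<Longrightarrow> k < n \<Longrightarrow> E v $$ (i, k) * E w $$ (k, j) \<le> E (v @ w) $$ (i, j)"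
  unfolding word_mat_append by (rule mult_mat_entry_ge) auto

lemma E_loop_ge: "i < n \<Longrightarrow> Fin (f i * real (length w)) \<le> E w $$ (i, i)"
proof (induction w)
  case (Cons l w)
  have "Fin (f i * real (length (l # w))) = M l $$ (i, i) * Fin (f i * real (length w))"
    using Cons.prems by (simp add: diag algebra_simps)
  also have "\<dots> \<le> M l $$ (i, i) * E w $$ (i, i)"
    using Cons by (intro trop_mult_mono) auto
  also have "\<dots> \<le> E (l # w) $$ (i, i)"
    unfolding word_mat_simps by (rule mult_mat_entry_ge) (use Cons.prems in auto)
  finally show ?case .
qed (simp add: one_trop_def)

definition walk_weight :: "letter list \<Rightarrow> (nat \<Rightarrow> nat) \<Rightarrow> nat \<Rightarrow> nat \<Rightarrow> trop" where
  "walk_weight w g a b = (\<Prod>t=a..<b. M (w ! t) $$ (g t, g (Suc t)))"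

lemma walk_weight_le:
  assumes g: "\<And>t. g t < n" and "a \<le> b" "b \<le> length w"
  shows "walk_weight w g a b \<le> E (take (b - a) (drop a w)) $$ (g a, g b)"
  using assms(2,3)
proof (induction b rule: dec_induct)
  case base
  show ?case using g by (simp add: walk_weight_def)
next
  case (step b)
  have tk: "take (Suc b - a) (drop a w) = take (b - a) (drop a w) @ [w ! b]"
    using step by (simp add: Suc_diff_le take_Suc_conv_app_nth)
  have "walk_weight w g a (Suc b) = walk_weight w g a b * E [w ! b] $$ (g b, g (Suc b))"
    using step unfolding word_mat_single by (simp add: walk_weight_def)
  also have "\<dots> \<le> E (take (b - a) (drop a w)) $$ (g a, g b) * E [w ! b] $$ (g b, g (Suc b))"
    using step by (intro trop_mult_mono) auto
  also have "\<dots> \<le> E (take (Suc b - a) (drop a w)) $$ (g a, g (Suc b))"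
    unfolding tk by (intro E_append_ge g)
  finally show ?case .
qed

lemma walk_weight_attained:
  assumes "i < n" "j < n" "E w $$ (i, j) \<noteq> 0"
  shows "\<exists>g. (\<forall>t. g t < n) \<and> g 0 = i \<and> g (length w) = j \<and>
    E w $$ (i, j) = walk_weight w g 0 (length w)"
  using assms(1,3)
proof (induction w arbitrary: i)
  case Nil
  then have "i = j" using assms(2) by (auto split: if_splits)
  then show ?case using Nil by (intro exI[of _ "\<lambda>_. i"]) (simp add: walk_weight_def)
next
  case (Cons l w)
  obtain z where z: "z < n" "E (l # w) $$ (i, j) = M l $$ (i, z) * E w $$ (z, j)"
    using mult_mat_entry_attained[of "M l" n n "E w" n i j] Cons.prems assms(2) n_pos by auto
  with Cons.prems have "E w $$ (z, j) \<noteq> 0" by auto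
  from Cons.IH[OF z(1) this] obtain g where g: "\<And>t. g t < n" "g 0 = z" "g (length w) = j"
      "E w $$ (z, j) = walk_weight w g 0 (length w)" by blast
  have "walk_weight (l # w) (case_nat i g) 0 (length (l # w)) = M l $$ (i, z) * walk_weight w g 0 (length w)"
    using g(2) by (simp add: walk_weight_def atLeast0LessThan prod.lessThan_Suc_shift del: prod.lessThan_Suc)
  moreover have "case_nat i g t < n" for t using g(1) Cons.prems by (cases t) auto
  ultimately show ?case using z g by (intro exI[of _ "case_nat i g"]) auto
qed

text \<open>The weight of the walk of length \<open>T\<close> along \<open>w\<close> that jumps from \<open>v r\<close> to \<open>v (Suc r)\<close> at
  time \<open>\<tau> r\<close> for \<open>r < k\<close> and stays where it is at all other times, rearranged so that the
  dependence on each \<open>\<tau> r\<close> is visible.\<close>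

definition jump_weight ::
    "letter list \<Rightarrow> nat \<Rightarrow> (nat \<Rightarrow> nat) \<Rightarrow> (nat \<Rightarrow> nat) \<Rightarrow> nat \<Rightarrow> trop" where
  "jump_weight w k v \<tau> T = (\<Prod>r<k. M (w ! \<tau> r) $$ (v r, v (Suc r)) *
     Fin ((f (v r) - f (v (Suc r))) * real (\<tau> r) - f (v (Suc r)))) * Fin (f (v k) * real T)"

lemma jump_weight_Suc:
  "jump_weight w (Suc k) v \<tau> T = jump_weight w k v \<tau> (\<tau> k) *
     (M (w ! \<tau> k) $$ (v k, v (Suc k)) * Fin (f (v (Suc k)) * (real T - real (Suc (\<tau> k)))))"
proof -
  have "Fin ((f (v k) - f (v (Suc k))) * real (\<tau> k) - f (v (Suc k))) * Fin (f (v (Suc k)) * real T)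
      = Fin (f (v k) * real (\<tau> k)) * Fin (f (v (Suc k)) * (real T - real (Suc (\<tau> k))))"
    by (simp add: algebra_simps)
  then have "P * (m * Fin ((f (v k) - f (v (Suc k))) * real (\<tau> k) - f (v (Suc k)))) * Fin (f (v (Suc k)) * real T)
      = P * Fin (f (v k) * real (\<tau> k)) * (m * Fin (f (v (Suc k)) * (real T - real (Suc (\<tau> k)))))" for P m
    by (metis mult.assoc mult.left_commute)
  then show ?thesis unfolding jump_weight_def prod.lessThan_Suc .
qed

lemma jump_weight_le:
  assumes "T \<le> length w" "\<And>r. r \<le> k \<Longrightarrow> v r < n" "\<And>r. r < k \<Longrightarrow> \<tau> r < T"
    and "\<And>r. Suc r < k \<Longrightarrow> \<tau> r < \<tau> (Suc r)"
  shows "jump_weight w k v \<tau> T \<le> E (take T w) $$ (v 0, v k)"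
  using assms
proof (induction k arbitrary: T)
  case 0
  then show ?case using E_loop_ge[of "v 0" "take T w"] by (simp add: jump_weight_def min_absorb2)
next
  case (Suc k)
  let ?c = "\<tau> k" and ?rest = "take (T - Suc (\<tau> k)) (drop (Suc (\<tau> k)) w)"
  have c: "?c < T" using Suc.prems by simp
  have cw: "?c \<le> length w" using c Suc.prems(1) by linarith
  have before: "\<tau> r < ?c" if "r < k" for r
    using strict_chain[of "Suc k" \<tau> r k] Suc.prems(4) that by simp
  have IH: "jump_weight w k v \<tau> ?c \<le> E (take ?c w) $$ (v 0, v k)"
    using Suc.prems before cw by (intro Suc.IH) auto
  have len: "length ?rest = T - Suc ?c" using Suc.prems(1) by simp
  have loop: "Fin (f (v (Suc k)) * (real T - real (Suc ?c))) \<le> E ?rest $$ (v (Suc k), v (Suc k))"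
    using E_loop_ge[of "v (Suc k)" ?rest, unfolded len] Suc.prems(2) c by (simp add: of_nat_diff)
  have "take T w = take ?c w @ ([w ! ?c] @ ?rest)"
    using c Suc.prems(1) id_take_nth_drop[of ?c "take T w"] by (simp add: drop_take min_def)
  then have tk: "E (take T w) = E (take ?c w @ ([w ! ?c] @ ?rest))" by simp
  have "jump_weight w (Suc k) v \<tau> T \<le> E (take ?c w) $$ (v 0, v k) *
      (E [w ! ?c] $$ (v k, v (Suc k)) * E ?rest $$ (v (Suc k), v (Suc k)))"
    unfolding jump_weight_Suc word_mat_single by (intro trop_mult_mono IH loop order_refl)
  also have "\<dots> \<le> E (take ?c w) $$ (v 0, v k) * E ([w ! ?c] @ ?rest) $$ (v k, v (Suc k))"
    using Suc.prems(2) by (intro trop_mult_mono E_append_ge order_refl) auto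
  also have "\<dots> \<le> E (take T w) $$ (v 0, v (Suc k))"
    unfolding tk using Suc.prems(2) by (intro E_append_ge) auto
  finally show ?case .
qed

text \<open>The bound is the weight of staying at \<open>i\<close> while \<open>v\<close> is read,
  so excursions from a vertex back to itself can be replaced by loops.\<close>

definition loop_dominated :: "letter list \<Rightarrow> bool" where
  "loop_dominated w \<longleftrightarrow> (\<forall>u v x i. w = u @ v @ x \<longrightarrow> i < n \<longrightarrow> E v $$ (i, i) \<le> Fin (f i * real (length v)))"

lemma loop_dominatedD:
  "loop_dominated w \<Longrightarrow> w = u @ v @ x \<Longrightarrow> i < n \<Longrightarrow> E v $$ (i, i) \<le> Fin (f i * real (length v))"
  by (auto simp: loop_dominated_def)

text \<open>Let \<open>a\<close> be the first time at the final vertex \<open>g T\<close>. By loop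
  dominance the walk after \<open>a\<close> may be replaced by staying there. Before
  \<open>a\<close> this vertex does not occur, so induction on the set of vertices applies, and the
  jump at time \<open>a - 1\<close> is appended.\<close>

lemma walk_le_jump_weight:
  assumes w: "loop_dominated w" and g: "\<And>t. g t < n"
    and "T \<le> length w" "finite S" "\<And>t. t \<le> T \<Longrightarrow> g t \<in> S"
  shows "\<exists>k v \<tau>. k \<le> card S \<and> v 0 = g 0 \<and> v k = g T \<and> (\<forall>r\<le>k. v r < n) \<and> (\<forall>r<k. \<tau> r < T) \<and>
    (\<forall>r. Suc r < k \<longrightarrow> \<tau> r < \<tau> (Suc r)) \<and> walk_weight w g 0 T \<le> jump_weight w k v \<tau> T"
  using assms(3-5)
proof (induction "card S" arbitrary: S T rule: less_induct)
  case less
  define a where "a = (LEAST t. g t = g T)"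
  have ga: "g a = g T" unfolding a_def by (rule LeastI[of _ T]) simp
  have aT: "a \<le> T" unfolding a_def by (rule Least_le) simp
  have before_a: "g t \<noteq> g T" if "t < a" for t using not_less_Least that unfolding a_def by blast
  have "w = take a w @ take (T - a) (drop a w) @ drop T w"
    using aT append_take_drop_id[of a w] append_take_drop_id[of "T - a" "drop a w"] by simp
  then have "E (take (T - a) (drop a w)) $$ (g T, g T) \<le> Fin (f (g T) * real (T - a))"
    using loop_dominatedD[OF w _ g[of T], of "take a w" "take (T - a) (drop a w)" "drop T w"]
      less.prems(1) by simp
  then have stay: "walk_weight w g a T \<le> Fin (f (g T) * (real T - real a))"
    using walk_weight_le[of g a T w, OF g aT less.prems(1)] ga aT by (simp add: of_nat_diff)
  have split: "walk_weight w g 0 T = walk_weight w g 0 a * walk_weight w g a T"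
    using aT by (simp add: walk_weight_def prod.atLeastLessThan_concat)
  show ?case
  proof (cases a)
    case 0
    then have "walk_weight w g 0 T \<le> jump_weight w 0 (\<lambda>_. g T) (\<lambda>_. 0) T"
      using stay by (simp add: jump_weight_def)
    then show ?thesis using 0 ga g[of T]
      by (intro exI[of _ 0] exI[of _ "\<lambda>_. g T"] exI[of _ "\<lambda>_. 0"]) auto
  next
    case (Suc c)
    let ?S = "S - {g T}"
    have gT: "g T \<in> S" using less.prems by simp
    have card: "Suc (card ?S) = card S" using gT less.prems(2) by (metis card_Suc_Diff1)
    have "\<exists>k v \<tau>. k \<le> card ?S \<and> v 0 = g 0 \<and> v k = g c \<and> (\<forall>r\<le>k. v r < n) \<and> (\<forall>r<k. \<tau> r < c) \<and>
      (\<forall>r. Suc r < k \<longrightarrow> \<tau> r < \<tau> (Suc r)) \<and> walk_weight w g 0 c \<le> jump_weight w k v \<tau> c"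
      using less.prems card Suc aT before_a by (intro less.hyps) auto
    then obtain k v \<tau> where IH: "k \<le> card ?S" "v 0 = g 0" "v k = g c" "\<forall>r\<le>k. v r < n"
      "\<forall>r<k. \<tau> r < c" "\<forall>r. Suc r < k \<longrightarrow> \<tau> r < \<tau> (Suc r)"
      "walk_weight w g 0 c \<le> jump_weight w k v \<tau> c" by blast
    let ?v = "v(Suc k := g T)" and ?\<tau> = "\<tau>(k := c)"
    have "walk_weight w g 0 T = walk_weight w g 0 c * (M (w ! c) $$ (g c, g T) * walk_weight w g a T)"
      using split ga unfolding Suc by (simp add: walk_weight_def mult.assoc)
    also have "\<dots> \<le> jump_weight w k v \<tau> c *
        (M (w ! c) $$ (g c, g T) * Fin (f (g T) * (real T - real a)))"
      by (intro trop_mult_mono IH stay order_refl)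
    also have "jump_weight w k v \<tau> c = jump_weight w k ?v ?\<tau> c"
      by (auto simp: jump_weight_def intro!: arg_cong2[where f = "(*)"] prod.cong)
    also have "\<dots> * (M (w ! c) $$ (g c, g T) * Fin (f (g T) * (real T - real a)))
        = jump_weight w (Suc k) ?v ?\<tau> T"
      unfolding jump_weight_Suc using IH(3) Suc by simp
    finally have "walk_weight w g 0 T \<le> jump_weight w (Suc k) ?v ?\<tau> T" .
    moreover have "\<forall>r<Suc k. ?\<tau> r < T" using IH(5) Suc aT by (auto simp: less_Suc_eq)
    moreover have "\<forall>r. Suc r < Suc k \<longrightarrow> ?\<tau> r < ?\<tau> (Suc r)" using IH(5,6) by auto
    moreover have "\<forall>r\<le>Suc k. ?v r < n" using IH(4) g by (auto simp: le_Suc_eq)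
    ultimately show ?thesis using IH(1,2) card
      by (intro exI[of _ "Suc k"] exI[of _ ?v] exI[of _ ?\<tau>]) auto
  qed
qed

text \<open>A best walk is replaced by a jump walk, whose jumps are then moved so that they read the
  same letters with \<open>l'\<close> in the middle. All other steps are loops, whose weight is the
  same for both letters.\<close>

lemma middle_letter_le:
  assumes q: "universal n q" and w: "loop_dominated (q @ [l] @ q)" and i: "i < n" and j: "j < n"
  shows "E (q @ [l] @ q) $$ (i, j) \<le> E (q @ [l'] @ q) $$ (i, j)"
proof (cases "E (q @ [l] @ q) $$ (i, j) = 0")
  case False
  let ?w = "q @ [l] @ q" and ?w' = "q @ [l'] @ q" and ?T = "2 * length q + 1"
  have T: "length ?w = ?T" "length ?w' = ?T" by simp_all
  obtain g where g: "\<And>t. g t < n" "g 0 = i" "g ?T = j" "E ?w $$ (i, j) = walk_weight ?w g 0 ?T"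
    using walk_weight_attained[OF i j False] unfolding T by blast
  obtain k v \<tau> where k: "k \<le> card {..<n}" "v 0 = i" "v k = j" "\<And>r. r \<le> k \<Longrightarrow> v r < n"
      and \<tau>: "\<And>r. r < k \<Longrightarrow> \<tau> r < ?T" "\<And>r. Suc r < k \<Longrightarrow> \<tau> r < \<tau> (Suc r)"
      and le: "walk_weight ?w g 0 ?T \<le> jump_weight ?w k v \<tau> ?T"
    using walk_le_jump_weight[of ?w g ?T "{..<n}", OF w g(1)] g T by auto
  obtain \<tau>' where \<tau>': "\<And>r. Suc r < k \<Longrightarrow> \<tau>' r < \<tau>' (Suc r)" "\<And>r. r < k \<Longrightarrow> \<tau>' r < ?T"
    "\<And>r. r < k \<Longrightarrow> ?w' ! \<tau>' r = ?w ! \<tau> r"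
    "(\<Sum>r<k. (f (v r) - f (v (Suc r))) * real (\<tau> r)) \<le> (\<Sum>r<k. (f (v r) - f (v (Suc r))) * real (\<tau>' r))"
    using move_jumps[where n = n and q = q and k = k and \<tau> = \<tau> and l = l and l' = l' and
        g = "\<lambda>r. f (v r) - f (v (Suc r))", OF q _ \<tau>(2,1)] k(1) by auto
  have "jump_weight ?w k v \<tau> ?T \<le> jump_weight ?w' k v \<tau>' ?T"
    unfolding jump_weight_def prod.distrib
  proof (intro trop_mult_mono order_refl)
    show "(\<Prod>r<k. M (?w ! \<tau> r) $$ (v r, v (Suc r))) \<le> (\<Prod>r<k. M (?w' ! \<tau>' r) $$ (v r, v (Suc r)))"
      using \<tau>'(3) by (intro trop_prod_mono) auto
    show "(\<Prod>r<k. Fin ((f (v r) - f (v (Suc r))) * real (\<tau> r) - f (v (Suc r))))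
        \<le> (\<Prod>r<k. Fin ((f (v r) - f (v (Suc r))) * real (\<tau>' r) - f (v (Suc r))))"
      using \<tau>'(4) by (simp add: prod_Fin sum_subtractf)
  qed
  also have "\<dots> \<le> E (take ?T ?w') $$ (v 0, v k)"
    using k \<tau>' T by (intro jump_weight_le) auto
  finally show ?thesis using le g(4) k T by simp
qed simp

lemma middle_letter_irrelevant:
  assumes "universal n q" "loop_dominated (q @ [La] @ q)" "loop_dominated (q @ [Lb] @ q)"
  shows "E (q @ [La] @ q) = E (q @ [Lb] @ q)"
proof (rule eq_matI)
  have dim: "dim_row (E w) = n" "dim_col (E w) = n" for w
    by (rule carrier_matD[OF word_carrier])+
  fix i j assume "i < dim_row (E (q @ [Lb] @ q))" "j < dim_col (E (q @ [Lb] @ q))"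
  then have "i < n" "j < n" by (auto simp only: dim)
  then show "E (q @ [La] @ q) $$ (i, j) = E (q @ [Lb] @ q) $$ (i, j)"
    using middle_letter_le assms by (intro order_antisym)
qed (simp_all add: carrier_matD[OF word_carrier])

end

section \<open>Common multiples of the first integers\<close>

text \<open>In the Vandermonde expansion of the coefficient over \<open>p ^ e + (2 * m - p ^ e)\<close>, the term
  without a factor divisible by \<open>p\<close> vanishes because \<open>2 * m - p ^ e < m\<close>.\<close>

lemma prime_dvd_central_binomial:
  fixes p :: nat
  assumes p: "prime p" and "m < p ^ e" "p ^ e \<le> 2 * m"
  shows "p dvd (2 * m choose m)"
proof -
  have "p dvd (p ^ e choose k) * ((2 * m - p ^ e) choose (m - k))" if "k \<le> m" for k
  proof (cases "k = 0")
    case True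
    then show ?thesis using assms by (simp add: binomial_eq_0)
  next
    case False
    have "p ^ e dvd k * (p ^ e choose k)"
      using times_binomial_minus1_eq[of k "p ^ e"] False by simp
    moreover have "\<not> p ^ e dvd k" using False that assms(2) by (auto dest: dvd_imp_le)
    ultimately have "\<not> coprime (p ^ e) (p ^ e choose k)"
      by (metis coprime_dvd_mult_left_iff)
    then have "\<not> coprime p (p ^ e choose k)" by (metis coprime_power_left_iff)
    then have "p dvd (p ^ e choose k)" using p by (metis prime_imp_coprime)
    then show ?thesis by simp
  qed
  then have "p dvd (\<Sum>k\<le>m. (p ^ e choose k) * ((2 * m - p ^ e) choose (m - k)))"
    by (intro dvd_sum) auto
  then show ?thesis
    using vandermonde[of "p ^ e" "2 * m - p ^ e" m] assms(3) by simp
qed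

text \<open>A prime power \<open>k = p ^ e\<close> above \<open>m\<close> needs one factor
  \<open>p\<close> beyond \<open>p ^ (e - 1)\<close>, which is at most \<open>m\<close>; the
  binomial coefficient supplies it. Any other \<open>k\<close> above \<open>m\<close> splits into
  two coprime factors greater than 1, both at most \<open>m\<close> and so dividing
  \<open>L\<close>.\<close>

lemma dvd_mult_central_binomial:
  fixes L :: nat
  assumes L: "\<And>j. 1 \<le> j \<Longrightarrow> j \<le> m \<Longrightarrow> j dvd L" and k: "1 \<le> k" "k \<le> 2 * m"
  shows "k dvd L * (2 * m choose m)"
proof (cases "k \<le> m")
  case True
  then show ?thesis using L k by simp
next
  case False
  show ?thesis
  proof (cases "k = 1")
    case False
    then obtain p where p: "prime p" "p dvd k" using prime_factor_nat by blast
    define e where "e = multiplicity p k"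
    obtain r where r: "k = p ^ e * r" "\<not> p dvd r"
      unfolding e_def using p k
      by (metis multiplicity_decompose' not_prime_unit not_one_le_zero)
    have e: "e \<noteq> 0" using r p by (metis power_0 mult_1)
    show ?thesis
    proof (cases "r = 1")
      case True
      obtain e' where e': "e = Suc e'" using e by (cases e) auto
      have "k = p * p ^ e'" using r True e' by simp
      moreover have "2 * p ^ e' \<le> p * p ^ e'"
        using prime_ge_2_nat[OF p(1)] by simp
      ultimately have "2 * p ^ e' \<le> 2 * m" using k by linarith
      moreover have "1 \<le> p ^ e'" using p by (simp add: prime_gt_0_nat Suc_leI)
      ultimately have "p ^ e' \<le> m" "1 \<le> p ^ e'" by auto
      then have "p ^ e' dvd L" using L by simp
      moreover have "p dvd (2 * m choose m)"
        using prime_dvd_central_binomial[OF p(1), of m e] r True k \<open>\<not> k \<le> m\<close> by simp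
      ultimately have "p ^ e' * p dvd L * (2 * m choose m)" by (rule mult_dvd_mono)
      then show ?thesis using \<open>k = p * p ^ e'\<close> by (simp add: mult.commute)
    next
      case False
      have r1: "1 < r" using False k r by (cases r) auto
      have pe: "1 < p ^ e" using prime_gt_1_nat[OF p(1)] e by (intro one_less_power) auto
      have "2 * p ^ e \<le> k" "2 * r \<le> k" using r r1 pe by auto
      then have "p ^ e dvd L" "r dvd L" using r1 pe k by (auto intro!: L)
      moreover have "coprime (p ^ e) r" using r(2) p by (simp add: prime_imp_coprime)
      ultimately have "k dvd L" unfolding r(1) by (rule divides_mult)
      then show ?thesis by simp
    qed
  qed simp
qed

text \<open>Recursion by halving: a common multiple for \<open>n / 2\<close>, rounded up to
  \<open>m\<close>, times the central binomial coefficient, which is at most \<open>4 ^ m\<close>,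
  serves for \<open>n\<close>.\<close>

lemma common_multiple_bound:
  assumes "2 \<le> n"
  shows "\<exists>L::nat. 0 < L \<and> (\<forall>k. 1 \<le> k \<longrightarrow> k \<le> n \<longrightarrow> k dvd L) \<and> L \<le> 4 ^ n * (n - 1)\<^sup>2"
  using assms
proof (induction n rule: less_induct)
  case (less n)
  show ?case
  proof (cases "n = 2")
    case True
    have "k dvd 2" if "1 \<le> k" "k \<le> 2" for k :: nat
    proof -
      have "k = 1 \<or> k = 2" using that by linarith
      then show ?thesis by auto
    qed
    then show ?thesis using True by (intro exI[of _ 2]) auto
  next
    case False
    define m where "m = (n + 1) div 2"
    have m: "2 \<le> m" "m < n" "n \<le> 2 * m" "2 * m \<le> n + 1" using False less.prems by (auto simp: m_def)
    obtain L where L: "0 < L" "\<And>k. 1 \<le> k \<Longrightarrow> k \<le> m \<Longrightarrow> k dvd L" "L \<le> 4 ^ m * (m - 1)\<^sup>2"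
      using less.IH[OF m(2,1)] by blast
    let ?L = "L * (2 * m choose m)"
    have "(2 * m choose m) \<le> 2 ^ (2 * m)" by (intro binomial_le_pow2)
    then have "?L \<le> (4 ^ m * (m - 1)\<^sup>2) * 4 ^ m"
      using L(3) by (intro mult_mono) (auto simp: power_mult)
    also have "\<dots> = 4 ^ (2 * m) * (m - 1)\<^sup>2" by (simp add: mult_2 power_add)
    also have "\<dots> \<le> 4 ^ n * (n - 1)\<^sup>2"
    proof (cases "n = 2 * m")
      case True
      then show ?thesis using m by (intro mult_mono power_mono) auto
    next
      case False
      \<comment> \<open>For odd \<open>n\<close>, rounding up costs a factor 4, which is just what
        the square gains.\<close>
      then have n: "Suc n = 2 * m" using m by simp
      then have "n - 1 = 2 * (m - 1)" by simp
      then have "(n - 1)\<^sup>2 = 4 * (m - 1)\<^sup>2" by (simp add: power_mult_distrib)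
      then show ?thesis unfolding n[symmetric] by simp
    qed
    finally have "?L \<le> 4 ^ n * (n - 1)\<^sup>2" .
    moreover have "0 < ?L" using L by (simp add: zero_less_binomial)
    moreover have "k dvd ?L" if "1 \<le> k" "k \<le> n" for k
      using that m by (intro dvd_mult_central_binomial L) auto
    ultimately show ?thesis by blast
  qed
qed

section \<open>Construction of the identities\<close>

definition all_words :: "nat \<Rightarrow> letter list" where
  "all_words n = concat (List.n_lists n [La, Lb])"

lemma length_all_words: "length (all_words n) = n * 2 ^ n"
proof -
  have "length (concat xss) = length xss * n" if "\<forall>xs\<in>set xss. length xs = n" for xss :: "letter list list"
    using that by (induction xss) auto
  then have "length (all_words n) = length (List.n_lists n [La, Lb]) * n"
    unfolding all_words_def by (simp add: set_n_lists)
  then show ?thesis by (simp add: length_n_lists mult.commute numeral_2_eq_2)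
qed

lemma universal_all_words: "universal n (all_words n)"
  unfolding universal_def
proof (intro allI impI)
  fix z :: "letter list" assume z: "length z \<le> n"
  let ?z = "z @ replicate (n - length z) La"
  have "set ?z \<subseteq> {La, Lb}" using letter.exhaust by blast
  then have "?z \<in> set (List.n_lists n [La, Lb])" using z by (simp add: set_n_lists)
  then obtain us vs where "List.n_lists n [La, Lb] = us @ ?z # vs" by (meson split_list)
  then have "all_words n = concat us @ z @ (replicate (n - length z) La @ concat vs)"
    by (simp add: all_words_def)
  then show "\<exists>a. a + length z \<le> length (all_words n) \<and> (\<forall>r<length z. all_words n ! (a + r) = z ! r)"
    by (intro exI[of _ "length (concat us)"]) (simp add: nth_append)
qed

section \<open>Optimal permutations of words\<close>

lemma permutes_funpow_eq_id:
  assumes \<sigma>: "\<sigma> permutes {..<n}" and L: "\<And>k. 1 \<le> k \<Longrightarrow> k \<le> n \<Longrightarrow> k dvd L"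
  shows "\<sigma> ^^ L = id"
proof
  fix i
  show "(\<sigma> ^^ L) i = id i"
  proof (cases "i < n")
    case True
    then obtain d where d: "1 \<le> d" "d \<le> n" "(\<sigma> ^^ d) i = i" using orbit_period[OF \<sigma>] by blast
    obtain m where m: "L = m * d" using L[OF d(1,2)] by (metis dvdE mult.commute)
    have "(\<sigma> ^^ (m * d)) i = i"
    proof (induction m)
      case (Suc m)
      then show ?case using funpow_periodic[OF d(3), of "m * d"] by (simp add: add.commute)
    qed simp
    then show ?thesis using m by simp
  next
    case False
    then show ?thesis using permutes_funpow[OF \<sigma>, of L] by (simp add: permutes_def)
  qed
qed

context matrix_pair begin

lemma nonsingular_factor:
  assumes "nonsingular n (word_mat n X Y (u @ v @ w)) \<pi>"
  obtains \<rho> where "nonsingular n (word_mat n X Y v) \<rho>"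
  using assms unfolding word_mat_append
  by (metis nonsingular_mult mult_carrier_mat word_carrier)

lemma nonsingular_replicate:
  assumes "nonsingular n (word_mat n X Y (replicate (Suc k) l)) \<pi>"
  shows "\<exists>\<sigma>. nonsingular n (letter_mat X Y l) \<sigma> \<and> \<pi> = \<sigma> ^^ Suc k"
  using assms
proof (induction k arbitrary: \<pi>)
  case 0
  then show ?case using word_mat_single[of l] by (intro exI[of _ \<pi>]) simp
next
  case (Suc k)
  have "nonsingular n (letter_mat X Y l * word_mat n X Y (replicate (Suc k) l)) \<pi>"
    using Suc.prems by simp
  from nonsingular_mult[OF letter_carrier word_carrier this]
  obtain \<beta> \<gamma> where \<beta>: "nonsingular n (letter_mat X Y l) \<beta>"
    and \<gamma>: "nonsingular n (word_mat n X Y (replicate (Suc k) l)) \<gamma>" and "\<pi> = \<gamma> \<circ> \<beta>" by metis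
  moreover obtain \<sigma> where "nonsingular n (letter_mat X Y l) \<sigma>" "\<gamma> = \<sigma> ^^ Suc k"
    using Suc.IH[OF \<gamma>] by blast
  ultimately show ?case
    using nonsingular_unique by (intro exI[of _ \<sigma>]) (metis funpow_Suc_right)
qed

lemma nonsingular_replicate_id:
  assumes "\<And>k. 1 \<le> k \<Longrightarrow> k \<le> n \<Longrightarrow> k dvd L" "0 < L"
    and "nonsingular n (word_mat n X Y (replicate L l)) \<pi>"
  shows "\<pi> = id"
proof -
  obtain k where "L = Suc k" using assms(2) by (cases L) auto
  then obtain \<sigma> where "nonsingular n (letter_mat X Y l) \<sigma>" "\<pi> = \<sigma> ^^ L"
    using nonsingular_replicate assms(3) by blast
  then show ?thesis using permutes_funpow_eq_id[of \<sigma> n L] assms(1) by (simp add: nonsingular_def)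
qed

text \<open>Both powers have the identity as optimal permutation, so the diagonal of the product is
  the product of the diagonals. This is symmetric in \<open>l\<close> and \<open>l'\<close>, which
  is why both orders of the two powers give the same diagonal.\<close>

lemma nonsingular_two_powers:
  assumes L: "\<And>k. 1 \<le> k \<Longrightarrow> k \<le> n \<Longrightarrow> k dvd L" "0 < L"
    and ns: "nonsingular n (word_mat n X Y (replicate L l @ replicate L l')) \<pi>"
  shows "\<pi> = id" and "i < n \<Longrightarrow> word_mat n X Y (replicate L l @ replicate L l') $$ (i, i) =
      word_mat n X Y (replicate L l) $$ (i, i) * word_mat n X Y (replicate L l') $$ (i, i)"
proof -
  obtain \<beta> \<gamma> where "nonsingular n (word_mat n X Y (replicate L l)) \<beta>"
      "nonsingular n (word_mat n X Y (replicate L l')) \<gamma>" "\<pi> = \<gamma> \<circ> \<beta>"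
      and entry: "\<And>i. i < n \<Longrightarrow> word_mat n X Y (replicate L l @ replicate L l') $$ (i, \<pi> i) =
        word_mat n X Y (replicate L l) $$ (i, \<beta> i) * word_mat n X Y (replicate L l') $$ (\<beta> i, \<gamma> (\<beta> i))"
    using nonsingular_mult[OF word_carrier word_carrier ns[unfolded word_mat_append]]
    unfolding word_mat_append by metis
  then have id: "\<beta> = id" "\<gamma> = id" using nonsingular_replicate_id[OF L] by blast+
  then show "\<pi> = id" using \<open>\<pi> = \<gamma> \<circ> \<beta>\<close> by simp
  show "word_mat n X Y (replicate L l @ replicate L l') $$ (i, i) =
      word_mat n X Y (replicate L l) $$ (i, i) * word_mat n X Y (replicate L l') $$ (i, i)" if "i < n"
    using entry[OF that] id \<open>\<pi> = \<gamma> \<circ> \<beta>\<close> by simp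
qed

end

text \<open>The optimal entries of a product split along the optimal permutations of its letters,
  here all the identity, so the diagonal only collects loops. This yields loop dominance.\<close>

lemma (in equal_diagonal_pair) nonsingular_word_diagonal:
  assumes id: "\<And>l. nonsingular n (M l) id" and "nonsingular n (E w) \<pi>"
  shows "\<pi> = id \<and> (\<forall>i<n. E w $$ (i, i) = Fin (f i * real (length w)))"
  using assms(2)
proof (induction w arbitrary: \<pi>)
  case Nil
  have "\<pi> i = i" if "i < n" for i
  proof -
    have "\<pi> i < n" using Nil that permutes_in_image by (fastforce simp: nonsingular_def)
    then show ?thesis using nonsingular_entry_neq_zero[OF Nil that] that by (auto split: if_splits)
  qed
  moreover have "\<pi> i = i" if "\<not> i < n" for i
    using Nil that by (simp add: nonsingular_def permutes_def)
  ultimately have "\<pi> = id" by (intro ext) (metis id_apply)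
  then show ?case by (simp add: one_trop_def)
next
  case (Cons l w)
  have ns: "nonsingular n (M l * E w) \<pi>" using Cons.prems by simp
  obtain \<beta> \<gamma> where "nonsingular n (M l) \<beta>" and \<gamma>: "nonsingular n (E w) \<gamma>" and \<pi>: "\<pi> = \<gamma> \<circ> \<beta>"
      and entry: "\<And>i. i < n \<Longrightarrow> (M l * E w) $$ (i, \<pi> i) = M l $$ (i, \<beta> i) * E w $$ (\<beta> i, \<gamma> (\<beta> i))"
    using nonsingular_mult[OF letter_carrier word_carrier ns] by metis
  have \<beta>: "\<beta> = id" using nonsingular_unique \<open>nonsingular n (M l) \<beta>\<close> id by blast
  show ?case using Cons.IH[OF \<gamma>] entry \<pi> \<beta> by (auto simp: diag algebra_simps)
qed

definition power_ab :: "nat \<Rightarrow> letter list" where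
  "power_ab L = replicate L La @ replicate L Lb"

definition power_ba :: "nat \<Rightarrow> letter list" where
  "power_ba L = replicate L Lb @ replicate L La"

text \<open>Every contiguous piece of the large word is nonsingular. The pieces consisting of one
  letter show that \<open>X\<close> and \<open>Y\<close> share their diagonal, and the longer ones
  give the loop dominance that \<open>middle_letter_irrelevant\<close> asks for.\<close>

lemma nonsingular_identity:
  assumes A: "A \<in> carrier_mat n n" and B: "B \<in> carrier_mat n n" and n: "0 < n"
    and L: "\<And>k. 1 \<le> k \<Longrightarrow> k \<le> n \<Longrightarrow> k dvd L" "0 < L" and q: "universal n q"
    and ns: "nonsingular n (word_mat n A B (subst_word (power_ab L) (power_ba L)
        ((q @ [La] @ q) @ (q @ [Lb] @ q)))) \<pi>"
  shows "word_mat n A B (subst_word (power_ab L) (power_ba L) (q @ [La] @ q)) =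
    word_mat n A B (subst_word (power_ab L) (power_ba L) (q @ [Lb] @ q))"
proof -
  interpret AB: matrix_pair n A B using A B by unfold_locales
  define X Y where "X = word_mat n A B (power_ab L)" and "Y = word_mat n A B (power_ba L)"
  interpret XY: matrix_pair n X Y by unfold_locales (auto simp: X_def Y_def)
  have subst: "word_mat n A B (subst_word (power_ab L) (power_ba L) w) = word_mat n X Y w" for w
    by (simp add: AB.word_mat_subst X_def Y_def)
  have factor: "\<exists>\<rho>. nonsingular n (word_mat n X Y v) \<rho>"
    if "(q @ [La] @ q) @ (q @ [Lb] @ q) = u @ v @ w" for u v w
    using ns XY.nonsingular_factor[of u v w \<pi>] unfolding subst that by blast
  have XL: "word_mat n X Y [La] = X" and YL: "word_mat n X Y [Lb] = Y"
    unfolding XY.word_mat_single by (simp_all add: letter_mat_def)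
  obtain \<rho> where "nonsingular n X \<rho>"
    using factor[of q "[La]" "q @ q @ [Lb] @ q"] unfolding XL by auto
  note X = this[unfolded X_def power_ab_def]
  obtain \<rho>' where "nonsingular n Y \<rho>'"
    using factor[of "q @ [La] @ q @ q" "[Lb]" q] unfolding YL by auto
  note Y = this[unfolded Y_def power_ba_def]
  have X_id: "nonsingular n X id"
    using X AB.nonsingular_two_powers(1)[OF L X] by (simp add: X_def power_ab_def)
  have Y_id: "nonsingular n Y id"
    using Y AB.nonsingular_two_powers(1)[OF L Y] by (simp add: Y_def power_ba_def)
  have XY_diag: "X $$ (i, i) = Y $$ (i, i)" if "i < n" for i
    using AB.nonsingular_two_powers(2)[OF L X that] AB.nonsingular_two_powers(2)[OF L Y that]
    by (simp add: X_def Y_def power_ab_def power_ba_def mult.commute)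
  have "\<exists>r. X $$ (i, i) = Fin r" if "i < n" for i
    using nonsingular_entry_neq_zero[OF X_id that] by (metis id_apply trop_not_zeroE)
  then obtain f where f: "\<And>i. i < n \<Longrightarrow> X $$ (i, i) = Fin (f i)" by metis
  interpret equal_diagonal_pair n X Y f
    using n f XY_diag by unfold_locales (auto simp: letter_mat_def split: letter.split)
  have "nonsingular n (letter_mat X Y l) id" for l
    using X_id Y_id by (auto simp: letter_mat_def split: letter.split)
  note word_diag = nonsingular_word_diagonal[OF this]
  have "loop_dominated w" if uwx: "(q @ [La] @ q) @ (q @ [Lb] @ q) = u @ w @ x" for u w x
    unfolding loop_dominated_def
  proof (intro allI impI)
    fix u' v x' i assume w: "w = u' @ v @ x'" and i: "i < n"
    obtain \<rho> where "nonsingular n (word_mat n X Y v) \<rho>"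
      using factor[of "u @ u'" v "x' @ x"] uwx w by auto
    then show "word_mat n X Y v $$ (i, i) \<le> Fin (f i * real (length v))"
      using word_diag i by simp
  qed
  from middle_letter_irrelevant[OF q this[of "[]" _ "q @ [Lb] @ q"] this[of "q @ [La] @ q" _ "[]"]]
  show ?thesis unfolding subst by simp
qed

section \<open>From dimension \<open>n - 1\<close> to dimension \<open>n\<close>\<close>

definition mat_identity :: "nat \<Rightarrow> letter list \<Rightarrow> letter list \<Rightarrow> bool" where
  "mat_identity n u v \<longleftrightarrow>
    (\<forall>X\<in>carrier_mat n n. \<forall>Y\<in>carrier_mat n n. word_mat n X Y u = word_mat n X Y v)"

lemma mat_identityD:
  "mat_identity n u v \<Longrightarrow> X \<in> carrier_mat n n \<Longrightarrow> Y \<in> carrier_mat n n \<Longrightarrow>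
     word_mat n X Y u = word_mat n X Y v"
  by (simp add: mat_identity_def)

text \<open>Shifting the brackets by one place turns the factors \<open>C * D * Z\<close> into
  \<open>D * Z * C\<close>, so the word is governed by matrices of size \<open>m\<close>.\<close>

lemma word_mat_factor:
  assumes C: "C \<in> carrier_mat n m" and D: "D \<in> carrier_mat m n"
    and Z: "Z \<in> carrier_mat n n" "Z' \<in> carrier_mat n n"
  shows "word_mat n (C * D * Z) (C * D * Z') w * (C * D) =
    C * word_mat m (D * Z * C) (D * Z' * C) w * D"
proof (induction w)
  case Nil
  show ?case using C D by simp
next
  case (Cons l w)
  define R where "R = letter_mat Z Z' l"
  let ?U = "word_mat n (C * D * Z) (C * D * Z') w" and ?V = "word_mat m (D * Z * C) (D * Z' * C) w"
  interpret P: matrix_pair n "C * D * Z" "C * D * Z'" using C D Z by unfold_locales auto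
  interpret Q: matrix_pair m "D * Z * C" "D * Z' * C" using C D Z by unfold_locales auto
  have R: "R \<in> carrier_mat n n" using Z by (simp add: R_def letter_mat_def split: letter.split)
  have U: "?U \<in> carrier_mat n n" and V: "?V \<in> carrier_mat m m" by simp_all
  have "letter_mat (C * D * Z) (C * D * Z') l = C * D * R" "letter_mat (D * Z * C) (D * Z' * C) l = D * R * C"
    by (auto simp: R_def letter_mat_def split: letter.split)
  then have lhs: "word_mat n (C * D * Z) (C * D * Z') (l # w) * (C * D) = C * D * R * ?U * (C * D)"
    and rhs: "C * word_mat m (D * Z * C) (D * Z' * C) (l # w) * D = C * (D * R * C * ?V) * D" by simp_all
  note lhs
  also have "C * D * R * ?U * (C * D) = C * D * R * (?U * (C * D))"
    by (rule assoc_mult_mat[of _ n n _ n _ n]) (use C D R U in auto)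
  also have "\<dots> = C * D * R * (C * ?V * D)" unfolding Cons.IH ..
  also have "C * D * R = C * (D * R)" by (rule assoc_mult_mat[OF C D R])
  also have "C * (D * R) * (C * ?V * D) = C * (D * R) * (C * ?V) * D"
    by (rule assoc_mult_mat[of _ n n _ m _ n, symmetric]) (use C D R V in auto)
  also have "C * (D * R) * (C * ?V) = C * (D * R * (C * ?V))"
    by (rule assoc_mult_mat[of _ n m _ n _ m]) (use C D R V in auto)
  also have "D * R * (C * ?V) = D * R * C * ?V"
    by (rule assoc_mult_mat[of _ m n _ m _ m, symmetric]) (use C D R V in auto)
  finally show ?case using rhs by simp
qed

text \<open>The length is \<open>length u * (length p + length Y1) + length p\<close>, where
  \<open>p\<close> consists of \<open>16 * n * n\<close> blocks as long as
  \<open>Y1\<close>.\<close>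

lemma identity_step:
  assumes n: "2 \<le> n" and L: "\<And>k. 1 \<le> k \<Longrightarrow> k \<le> n \<Longrightarrow> k dvd L" "0 < L" and q: "universal n q"
    and uv: "length u = length v" "u \<noteq> v" "mat_identity (n - 1) u v"
  shows "\<exists>u' v'. length u' = length v' \<and> u' \<noteq> v' \<and> mat_identity n u' v' \<and>
    length u' = length u * ((16 * n * n + 1) * ((2 * length q + 1) * (2 * L)))
      + 16 * n * n * ((2 * length q + 1) * (2 * L))"
proof -
  define Y1 Y2 where "Y1 = subst_word (power_ab L) (power_ba L) (q @ [La] @ q)"
    and "Y2 = subst_word (power_ab L) (power_ba L) (q @ [Lb] @ q)"
  have ab: "length (power_ab L) = length (power_ba L)" "length (power_ab L) = 2 * L"
    by (simp_all add: power_ab_def power_ba_def)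
  have "hd (power_ab L) \<noteq> hd (power_ba L)"
    using L(2) by (cases L) (simp_all add: power_ab_def power_ba_def)
  then have ab_ne: "power_ab L \<noteq> power_ba L" by auto
  have len: "length Y1 = (2 * length q + 1) * (2 * L)" "length Y2 = (2 * length q + 1) * (2 * L)"
    unfolding Y1_def Y2_def length_subst_word[OF ab(1)] ab(2) by simp_all
  have ne: "Y1 \<noteq> Y2"
    using subst_word_inj[OF ab(1) ab_ne, of "q @ [La] @ q" "q @ [Lb] @ q"] by (auto simp: Y1_def Y2_def)
  define p where "p = concat (replicate (2 * (4 * n * n)) (Y1 @ Y2))"
  have "length (concat (replicate k w)) = k * length w" for k and w :: "letter list"
    by (induction k) auto
  then have len_p: "length p = 16 * n * n * ((2 * length q + 1) * (2 * L))"
    unfolding p_def by (simp add: len algebra_simps)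
  define u' v' where "u' = subst_word (p @ Y1) (p @ Y2) u @ p" and "v' = subst_word (p @ Y1) (p @ Y2) v @ p"
  have lens: "length (p @ Y1) = length (p @ Y2)" by (simp add: len)
  have "length u' = length v'"
    by (simp add: u'_def v'_def length_subst_word[OF lens] uv)
  moreover have "u' \<noteq> v'"
    using subst_word_inj[OF lens, of u v] ne uv by (auto simp: u'_def v'_def)
  moreover have "length u' = length u * ((16 * n * n + 1) * ((2 * length q + 1) * (2 * L)))
      + 16 * n * n * ((2 * length q + 1) * (2 * L))"
    unfolding u'_def length_append length_subst_word[OF lens] len_p len by (simp add: algebra_simps)
  moreover have "mat_identity n u' v'"
    unfolding mat_identity_def
  proof (intro ballI)
    fix A B :: "trop mat" assume A: "A \<in> carrier_mat n n" and B: "B \<in> carrier_mat n n"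
    interpret matrix_pair n A B using A B by unfold_locales
    let ?E = "word_mat n A B"
    have split: "?E (subst_word (p @ Y1) (p @ Y2) w @ p)
        = word_mat n (?E p * ?E Y1) (?E p * ?E Y2) w * ?E p" for w
      by (simp add: word_mat_append word_mat_subst)
    have Ep: "?E p = ?E (Y1 @ Y2) ^\<^sub>m (2 * (4 * n * n))"
      unfolding p_def by (rule word_mat_replicate)
    have YY: "?E (Y1 @ Y2) \<in> carrier_mat n n" by simp
    show "?E u' = ?E v'"
    proof (cases rule: nonsingular_or_factor[OF YY n order_refl])
      case (1 \<sigma>)
      then have "?E Y1 = ?E Y2"
        using nonsingular_identity[OF A B _ L q, of \<sigma>] n by (simp add: Y1_def Y2_def)
      \<comment> \<open>With equal blocks the value depends on the length of the word alone, and
        \<open>u\<close> and \<open>v\<close> are equally long.\<close>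
      then show ?thesis
        unfolding u'_def v'_def split using uv(1) word_mat_same[of n _ u] word_mat_same[of n _ v] by simp
    next
      case (2 C D)
      have D: "D * ?E Y1 * C \<in> carrier_mat (n - 1) (n - 1)" "D * ?E Y2 * C \<in> carrier_mat (n - 1) (n - 1)"
        using 2 by auto
      show ?thesis
        unfolding u'_def v'_def split Ep 2(3) word_mat_factor[OF 2(1,2) word_carrier word_carrier]
          mat_identityD[OF uv(3) D] ..
    qed
  qed
  ultimately show ?thesis by blast
qed

lemma mat_identity_one: "mat_identity 1 [La, Lb] [Lb, La]"
  unfolding mat_identity_def
proof (intro ballI)
  fix X Y :: "trop mat" assume X: "X \<in> carrier_mat 1 1" and Y: "Y \<in> carrier_mat 1 1"
  have "X * Y = Y * X"
    using X Y by (intro eq_matI) (auto simp: scalar_prod_def mult.commute)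
  then show "word_mat 1 X Y [La, Lb] = word_mat 1 X Y [Lb, La]"
    using X Y right_mult_one_mat[OF X] right_mult_one_mat[OF Y] by (simp add: letter_mat_def)
qed

section \<open>Growth of the length\<close>

definition length_bound :: "nat \<Rightarrow> nat" where
  "length_bound n = (200 * n ^ 5) ^ n * 8 ^ (\<Sum>{1..n})"

text \<open>The factor \<open>8 ^ n\<close> is \<open>2 ^ n\<close> from the universal word times
  \<open>4 ^ n\<close> from the common multiple. The polynomial factors multiply to
  \<open>33 * n ^ 2 * 6 * n ^ 3\<close>, below \<open>200 * n ^ 5\<close>;
  \<open>length_bound\<close> uses this last one for all earlier steps too.\<close>

lemma step_length_le:
  fixes n l L :: nat
  assumes n: "2 \<le> n" and l: "1 \<le> l" "l \<le> length_bound (n - 1)" and L: "L \<le> 4 ^ n * (n - 1)\<^sup>2"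
  shows "l * ((16 * n * n + 1) * ((2 * (n * 2 ^ n) + 1) * (2 * L)))
      + 16 * n * n * ((2 * (n * 2 ^ n) + 1) * (2 * L)) \<le> length_bound n"
proof -
  have L': "L \<le> 4 ^ n * n\<^sup>2" by (rule order_trans[OF L]) (intro mult_mono power_mono, auto)
  define Q where "Q = (2 * (n * 2 ^ n) + 1) * (2 * L)"
  have "2 * (n * 2 ^ n) + 1 \<le> 3 * (n * 2 ^ n)" using n by simp
  then have "Q \<le> (3 * (n * 2 ^ n)) * (2 * (4 ^ n * n\<^sup>2))"
    unfolding Q_def using L' by (intro mult_mono) auto
  also have "\<dots> = 6 * n ^ 3 * 8 ^ n"
  proof -
    have "(8::nat) ^ n = 2 ^ n * 4 ^ n" by (simp flip: power_mult_distrib)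
    moreover have "n ^ 3 = n * n\<^sup>2" by (simp add: power2_eq_square power3_eq_cube)
    ultimately show ?thesis by simp
  qed
  finally have Q: "Q \<le> 6 * n ^ 3 * 8 ^ n" .
  have "l * ((16 * n * n + 1) * Q) + 16 * n * n * Q \<le> l * ((16 * n * n + 1) * Q) + l * (16 * n * n * Q)"
    using l(1) by simp
  also have "\<dots> = l * ((32 * n * n + 1) * Q)" by (simp add: algebra_simps)
  also have "\<dots> \<le> l * ((33 * n\<^sup>2) * (6 * n ^ 3 * 8 ^ n))"
    using n Q by (intro mult_mono) (auto simp: power2_eq_square)
  also have "\<dots> = l * (198 * n ^ 5 * 8 ^ n)"
    using power_add[of n 2 3] by simp
  also have "\<dots> \<le> ((200 * n ^ 5) ^ (n - 1) * 8 ^ (\<Sum>{1..n - 1})) * (200 * n ^ 5 * 8 ^ n)"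
  proof (intro mult_mono)
    have "length_bound (n - 1) \<le> (200 * n ^ 5) ^ (n - 1) * 8 ^ (\<Sum>{1..n - 1})"
      unfolding length_bound_def by (intro mult_mono power_mono) auto
    then show "l \<le> (200 * n ^ 5) ^ (n - 1) * 8 ^ (\<Sum>{1..n - 1})" using l by simp
  qed auto
  also have "\<dots> = length_bound n"
  proof -
    obtain m where m: "n = Suc m" using n by (cases n) auto
    have "(\<Sum>{1..n}) = (\<Sum>{1..n - 1}) + n" by (simp add: m)
    moreover have "(200 * n ^ 5) ^ n = (200 * n ^ 5) ^ (n - 1) * (200 * n ^ 5)"
      by (simp only: m power_Suc2 diff_Suc_1)
    ultimately show ?thesis unfolding length_bound_def by (simp only: power_add mult_ac)
  qed
  finally show ?thesis unfolding Q_def .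
qed

lemma short_mat_identity:
  assumes "1 \<le> n"
  shows "\<exists>u v. length u = length v \<and> u \<noteq> v \<and> mat_identity n u v \<and> length u \<le> length_bound n"
  using assms
proof (induction n rule: dec_induct)
  case base
  show ?case using mat_identity_one by (intro exI[of _ "[La, Lb]"] exI[of _ "[Lb, La]"])
    (simp add: length_bound_def)
next
  case (step m)
  define n where "n = Suc m"
  have n: "2 \<le> n" "n - 1 = m" using step by (auto simp: n_def)
  obtain u v where uv: "length u = length v" "u \<noteq> v" "mat_identity (n - 1) u v"
    "length u \<le> length_bound (n - 1)" using step.IH n(2) by auto
  have u: "1 \<le> length u" using uv(1,2) by (cases u) auto
  obtain L where L: "0 < L" "\<And>k. 1 \<le> k \<Longrightarrow> k \<le> n \<Longrightarrow> k dvd L" "L \<le> 4 ^ n * (n - 1)\<^sup>2"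
    using common_multiple_bound[OF n(1)] by blast
  from identity_step[OF n(1) L(2,1) universal_all_words uv(1-3), unfolded length_all_words]
    step_length_le[OF n(1) u uv(4) L(3)]
  show ?case unfolding n_def[symmetric] by metis
qed

text \<open>A homomorphism from the free semigroup is evaluation at its values on the two
  letters.\<close>

lemma satisfies_identity_if_mat_identity:
  assumes "mat_identity n u v" "u \<noteq> []" "v \<noteq> []"
  shows "satisfies_identity (trop_mat_monoid n) u v"
  unfolding satisfies_identity_def
proof
  fix \<phi> assume \<phi>: "\<phi> \<in> hom free_semigroup (trop_mat_monoid n)"
  have carrier: "\<phi> w \<in> carrier_mat n n" if "w \<noteq> []" for w
    using \<phi> that by (auto simp: hom_def free_semigroup_def trop_mat_monoid_def)
  have mult: "\<phi> (v @ w) = \<phi> v * \<phi> w" if "v \<noteq> []" "w \<noteq> []" for v w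
    using \<phi> that by (auto simp: hom_def free_semigroup_def trop_mat_monoid_def)
  interpret matrix_pair n "\<phi> [La]" "\<phi> [Lb]" using carrier by unfold_locales auto
  have letter: "letter_mat (\<phi> [La]) (\<phi> [Lb]) l = \<phi> [l]" for l
    by (simp add: letter_mat_def split: letter.split)
  have \<phi>_word: "\<phi> w = word_mat n (\<phi> [La]) (\<phi> [Lb]) w" if "w \<noteq> []" for w
    using that
  proof (induction w rule: list_nonempty_induct)
    case (single l)
    then show ?case using word_mat_single[of l] letter by simp
  next
    case (cons l w)
    then show ?case using mult[of "[l]" w] letter by simp
  qed
  show "\<phi> u = \<phi> v"
    unfolding \<phi>_word[OF assms(2)] \<phi>_word[OF assms(3)] by (rule mat_identityD[OF assms(1) X Y])
qed

text \<open>As \<open>8 = 2 ^ 3\<close> and the exponents sum to \<open>n * (n + 1) / 2\<close>, the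
  quadratic coefficient of the logarithm is \<open>3 / 2 * ln 2\<close>.\<close>

lemma length_bound_exp:
  assumes "1 \<le> n"
  shows "real (length_bound n) =
    exp (3 / 2 * ln 2 * (real n)\<^sup>2 + (3 / 2 * ln 2 * real n + real n * ln (200 * real n ^ 5)))"
proof -
  have "real (8 ^ m) = exp (ln 8 * real m)" for m
    by (simp add: exp_of_nat2_mult)
  then have "real (8 ^ (\<Sum>{1..n})) = exp (ln 8 * real (\<Sum>{1..n}))" .
  also have "real (\<Sum>{1..n}) = real n * (real n + 1) / 2"
    by (induction n) (simp_all add: field_simps)
  also have "ln (8 :: real) = 3 * ln 2" using ln_realpow[of 2 3] by simp
  finally have "real (8 ^ (\<Sum>{1..n})) = exp (3 * ln 2 * (real n * (real n + 1) / 2))" .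
  moreover have "real ((200 * n ^ 5) ^ n) = exp (real n * ln (200 * real n ^ 5))"
    using assms by (simp add: exp_of_nat_mult)
  ultimately show ?thesis
    unfolding length_bound_def of_nat_mult exp_add[symmetric]
    by (simp add: algebra_simps power2_eq_square flip: exp_add)
qed

theorem theorem3p7:
  shows "(\<forall>n\<ge>1. \<exists>u v. semigroup_identity u v \<and> satisfies_identity (trop_mat_monoid n) u v) \<and>
    (\<exists>(C::real) (u :: nat \<Rightarrow> letter list) (v :: nat \<Rightarrow> letter list) (\<epsilon> :: nat \<Rightarrow> real).
       C \<le> 1 / 2 + ln 2 \<and>
       (\<forall>n\<ge>1. semigroup_identity (u n) (v n) \<and>
               satisfies_identity (trop_mat_monoid n) (u n) (v n)) \<and>
       \<epsilon> \<in> o(\<lambda>n. (real n)\<^sup>2) \<and>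
       (\<forall>n\<ge>1. real (identity_length (u n) (v n)) = exp (C * (real n)\<^sup>2 + \<epsilon> n)))"
proof -
  define C :: real where "C = 3 / 2 * ln 2"
  define U V where "U n = (SOME w. \<exists>v. length w = length v \<and> w \<noteq> v \<and> mat_identity n w v \<and>
      length w \<le> length_bound n)"
    and "V n = (SOME v. length (U n) = length v \<and> U n \<noteq> v \<and> mat_identity n (U n) v \<and>
      length (U n) \<le> length_bound n)" for n
  have UV: "length (U n) = length (V n) \<and> U n \<noteq> V n \<and> mat_identity n (U n) (V n) \<and>
      length (U n) \<le> length_bound n" if "1 \<le> n" for n
    unfolding V_def by (rule someI_ex) (unfold U_def, rule someI_ex, rule short_mat_identity[OF that])
  \<comment> \<open>A common suffix preserves the identity and brings the length up to at least the
    desired exponential, however short \<open>U n\<close> is.\<close>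
  define pad where "pad n = replicate (nat \<lceil>exp (C * (real n)\<^sup>2)\<rceil>) La" for n
  define u v where "u n = U n @ pad n" and "v n = V n @ pad n" for n
  define len where "len n = real (identity_length (u n) (v n))" for n
  define \<epsilon> where "\<epsilon> n = ln (len n) - C * (real n)\<^sup>2" for n
  define \<delta> where "\<delta> n = C * real n + real n * ln (200 * real n ^ 5)" for n
  have identity: "semigroup_identity (u n) (v n) \<and> satisfies_identity (trop_mat_monoid n) (u n) (v n)"
    if n: "1 \<le> n" for n
  proof -
    have ne: "u n \<noteq> v n" "U n \<noteq> []" "V n \<noteq> []" using UV[OF n] by (auto simp: u_def v_def)
    have "mat_identity n (u n) (v n)"
      unfolding mat_identity_def
    proof (intro ballI)
      fix X Y :: "trop mat" assume XY: "X \<in> carrier_mat n n" "Y \<in> carrier_mat n n"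
      interpret matrix_pair n X Y using XY by unfold_locales
      show "word_mat n X Y (u n) = word_mat n X Y (v n)"
        using UV[OF n] mat_identityD[of n "U n" "V n", OF _ XY] by (simp add: u_def v_def word_mat_append)
    qed
    then show ?thesis using ne satisfies_identity_if_mat_identity
      by (simp add: semigroup_identity_def free_semigroup_def u_def v_def)
  qed
  have len: "len n = real (length (U n)) + real_of_int \<lceil>exp (C * (real n)\<^sup>2)\<rceil>" if "1 \<le> n" for n
    using UV[OF that] by (simp add: len_def identity_length_def u_def v_def pad_def)
  have lower: "exp (C * (real n)\<^sup>2) \<le> len n" if "1 \<le> n" for n
    unfolding len[OF that] by (simp add: add_increasing le_of_int_ceiling)
  \<comment> \<open>The factor 3 accounts for the length of \<open>U n\<close>, the exponential and
    the rounding error of at most 1.\<close>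
  have upper: "len n \<le> 3 * exp (C * (real n)\<^sup>2 + \<delta> n)" if "1 \<le> n" for n
  proof -
    have C: "0 \<le> C" by (simp add: C_def)
    have "1 \<le> real n ^ 5" using that by simp
    then have "0 \<le> ln (200 * real n ^ 5)" by (intro ln_ge_zero) linarith
    then have \<delta>: "0 \<le> \<delta> n" using C by (simp add: \<delta>_def)
    have "real (length (U n)) \<le> exp (C * (real n)\<^sup>2 + \<delta> n)"
      using UV[OF that] length_bound_exp[OF that] by (simp add: C_def \<delta>_def flip: of_nat_le_iff)
    moreover have "real_of_int \<lceil>exp (C * (real n)\<^sup>2)\<rceil> \<le> exp (C * (real n)\<^sup>2) + 1" by linarith
    moreover have "exp (C * (real n)\<^sup>2) \<le> exp (C * (real n)\<^sup>2 + \<delta> n)" using \<delta> by simp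
    moreover have "1 \<le> exp (C * (real n)\<^sup>2 + \<delta> n)" using \<delta> C by simp
    ultimately show ?thesis unfolding len[OF that] by linarith
  qed
  have pos: "0 < len n" if "1 \<le> n" for n
    using lower[OF that] exp_gt_zero[of "C * (real n)\<^sup>2"] by linarith
  have "\<bar>\<epsilon> n\<bar> \<le> \<bar>ln 3 + \<delta> n\<bar>" if "1 \<le> n" for n
  proof -
    have "C * (real n)\<^sup>2 \<le> ln (len n)" using lower[OF that] pos[OF that] by (simp add: ln_ge_iff)
    moreover have "ln (len n) \<le> ln (3 * exp (C * (real n)\<^sup>2 + \<delta> n))"
      using upper[OF that] pos[OF that] by (simp add: ln_le_cancel_iff)
    then have "ln (len n) \<le> ln 3 + (C * (real n)\<^sup>2 + \<delta> n)" by (simp add: ln_mult)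
    ultimately show ?thesis by (simp add: \<epsilon>_def)
  qed
  then have "\<epsilon> \<in> O(\<lambda>n. ln 3 + \<delta> n)"
    by (intro bigoI[of _ 1] eventually_at_top_linorderI[of 1]) simp
  also have "(\<lambda>n. ln 3 + \<delta> n) \<in> o(\<lambda>n. (real n)\<^sup>2)"
    unfolding \<delta>_def C_def by real_asymp
  finally have "\<epsilon> \<in> o(\<lambda>n. (real n)\<^sup>2)" .
  moreover have "len n = exp (C * (real n)\<^sup>2 + \<epsilon> n)" if "1 \<le> n" for n
    using pos[OF that] by (simp add: \<epsilon>_def)
  \<comment> \<open>This amounts to \<open>ln 2 \<le> 1\<close>.\<close>
  moreover have "C \<le> 1 / 2 + ln 2" using ln_2_less_1 by (simp add: C_def)
  ultimately show ?thesis using identity unfolding len_def by blast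
qed

end
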